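(* Let $\underline W\in\underline{\mathcal S}'$ satisfy axioms A1)–A7) listed in the context, where the Hilbert space structure condition A5) holds with a Hilbert seminorm $\underline p$ that is Sobolev dominated, and let $\mathcal H,\phi,\Omega$ be the associated Krein space representation. Then $\phi$ is strongly continuous in the following sense: if $\underline f_n\to\underline f$ in $\underline{\mathcal S}$ (a sequence), then $\phi(\underline f_n)\Omega\to\phi(\underline f)\Omega$ strongly in $\mathcal H$.
   Context: **Borchers algebra.** Fix $d\ge2$ and Minkowski space $\mathbb R^d$ with $x\cdot y=x^0y^0-\sum_{j=1}^{d-1}x^jy^j$. Let $\mathcal S_0=\mathbb C$, $\mathcal S_n=\mathcal S(\mathbb R^{dn},\mathbb C)$ (Schwartz functions) and $\underline{\mathcal S}=\bigoplus_{n\ge0}\mathcal S_n$ (finite sequences $\underline f=(f_0,f_1,\dots)$) with the locally convex direct sum topology, product $(\underline f\otimes\underline h)_n=\sum_{j+l=n}f_j\otimes h_l$, unit $\mathbf 1=(1,0,\dots)$, and involution $f_l^*(x_1,\dots,x_l)=\overline{f_l(x_l,\dots,x_1)}$. $\underline{\mathcal S}'$ is the topological dual. The proper orthochronous Poincaré group $P_+^\uparrow$ acts by continuous $*$-automorphisms $\underline\alpha_{\{\Lambda,a\}}$, $(\underline\alpha_{\{\Lambda,a\}}f_n)(x_1,\dots,x_n)=f_n(\Lambda^{-1}(x_1-a),\dots,\Lambda^{-1}(x_n-a))$. $I_{\rm sp}$ is the left ideal generated by all $\int_{\mathbb R^d}\underline\alpha_{\{1,a\}}(\underline f)h(a)\,da$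 with $\underline f\in\underline{\mathcal S}$, $h\in\mathcal S_1$, $\operatorname{supp}\hat h\cap\bar V_0^+=\emptyset$, where $\hat h(k)=\int e^{ik\cdot a}h(a)\,da$ and $\bar V_0^+=\{k:k^0\ge0,\ k\cdot k\ge0\}$. $I_{\rm loc}$ is the two-sided ideal generated by $(0,0,f_1\otimes h_1-h_1\otimes f_1,0,\dots)$ with $f_1,h_1\in\mathcal S_1$ having space-like separated supports. **Axioms for $\underline W$.** A1) $\underline W\in\underline{\mathcal S}'$, $W_0=1$. A2) $\underline W\circ\underline\alpha_{\{\Lambda,a\}}=\underline W$ for all $\{\Lambda,a\}\in P_+^\uparrow$. A3) $I_{\rm sp}\subseteq\ker\underline W$. A4) $I_{\rm loc}\subseteq\ker\underline W$. A5) There is a Hilbert seminorm $\underline p$ on $\underline{\mathcal S}$ (one coming from a positive semidefinite sesquilinear form) with $|\underline W(\underline f^*\otimes\underline g)|\le\underline p(\underline f)\underline p(\underline g)$ for all $\underline f,\underline g$. A6) $\lim_{t\to\infty}\underline W(\underline f\otimes\underline\alpha_{\{1,ta\}}(\underline g))=\underline W(\underline f)\underline W(\underline g)$ for all $\underline f,\underline g$ and space-like $a$. A7) $\underline W(\underline f^* )=\overline{\underline W(\underline f)}$. The seminorm $\underline p$ is *Sobolev dominated* if it is continuous in the topology of $\underline{\mathcal S}$. **Associated Krein space representation.** If $\underline p$ is not a norm, replace it by $\sqrt{\underline p^2+\underline p_1^2}$, with $\underline p_1$ a Hilbert norm on $\underline{\mathcal S}$ that is a direct sum of Sobolev Hilbert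 norms on the $\mathcal S_n$. Let $\mathcal H_1$ be the completion of $\underline{\mathcal S}$ in $\underline p$; extend $\langle\underline f,\underline g\rangle=\underline W(\underline f^*\otimes\underline g)$ continuously to $\mathcal H_1$. Let $\mathcal K_0=\{v\in\mathcal H_1:\langle w,v\rangle=0\ \forall w\in\mathcal H_1\}$, $\mathcal H_2=\mathcal H_1/\mathcal K_0$ (quotient Hilbert space, scalar product $(\cdot,\cdot)_2$) with quotient map $\pi$; $\langle\cdot,\cdot\rangle$ descends to $\mathcal H_2$ and equals $(\cdot,\eta_2\cdot)_2$ for an injective self-adjoint contraction $\eta_2$. Set $\mathcal D=\pi(\underline{\mathcal S})$, $\Omega=\pi(\mathbf 1)$, $(\cdot,\cdot)=(\cdot,|\eta_2|\cdot)_2$, let $\mathcal H$ be the completion of $\mathcal D$ in $\|\cdot\|=(\cdot,\cdot)^{1/2}$ and $\eta=\operatorname{sign}(\eta_2)$ extended to $\mathcal H$, so that $\langle\cdot,\cdot\rangle=(\cdot,\eta\,\cdot)$ (one may pass to a topologically equivalent scalar product and corresponding metric operator such that $\eta\Omega=\Omega$). $\phi(\underline f):\mathcal D\to\mathcal D$ is the well-defined operator $\phi(\underline f)\pi(\underline g)=\pi(\underline f\otimes\underline g)$. *)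

theory Defs
  imports "HOL-Analysis.Analysis" "HOL-Library.Function_Algebras"
begin

section \<open>Minkowski space\<close>

text \<open>The coordinate index \<^term>\<open>None\<close> is time, the indices \<open>Some j\<close> are the spatial
  directions. As types are nonempty, \<open>d = CARD('s option) = CARD('s) + 1\<close> ranges over all
  \<open>d \<ge> 2\<close>.\<close>

type_synonym 's spacetime = "real ^ 's option"

definition mdot :: "('s::finite) spacetime \<Rightarrow> 's spacetime \<Rightarrow> real" where
  "mdot x y = x $ None * y $ None - (\<Sum>j\<in>UNIV. x $ Some j * y $ Some j)"

definition spacelike :: "('s::finite) spacetime \<Rightarrow> bool" where
  "spacelike a \<longleftrightarrow> mdot a a < 0"

definition closed_forward_cone :: "('s::finite) spacetime set" where
  "closed_forward_cone = {k. k $ None \<ge> 0 \<and> mdot k k \<ge> 0}"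

definition proper_orthochronous :: "real ^ ('s::finite) option ^ 's option \<Rightarrow> bool" where
  "proper_orthochronous \<Lambda> \<longleftrightarrow>
     (\<forall>x y. mdot (\<Lambda> *v x) (\<Lambda> *v y) = mdot x y) \<and> det \<Lambda> = 1 \<and> \<Lambda> $ None $ None > 0"


section \<open>Schwartz functions of \<open>n\<close> space-time arguments\<close>

text \<open>A point of \<open>\<real>\<^sup>d\<^sup>n\<close> is a list of \<open>n\<close> points of \<open>\<real>\<^sup>d\<close>. A sequence \<open>(f\<^sub>0, f\<^sub>1, \<dots>)\<close> of functions
  \<open>f\<^sub>n\<close> on \<open>\<real>\<^sup>d\<^sup>n\<close> is a single function on lists of arbitrary length, whose restriction to the
  lists of length \<open>n\<close> is \<open>f\<^sub>n\<close>. A single function \<open>f\<^sub>n\<close> is identified with the sequence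
  \<open>(0, \<dots>, 0, f\<^sub>n, 0, \<dots>)\<close>, i.e. it vanishes on lists of any other length.\<close>

type_synonym 's fseq = "'s spacetime list \<Rightarrow> complex"

definition scaleB :: "complex \<Rightarrow> ('s::finite) fseq \<Rightarrow> 's fseq" where
  "scaleB c f = (\<lambda>xs. c * f xs)"

definition component :: "nat \<Rightarrow> ('s::finite) fseq \<Rightarrow> 's fseq" where
  "component n f = (\<lambda>xs. if length xs = n then f xs else 0)"

definition list_norm :: "('s::finite) spacetime list \<Rightarrow> real" where
  "list_norm xs = sqrt (\<Sum>x\<leftarrow>xs. (norm x)\<^sup>2)"

definition partial :: "nat \<Rightarrow> ('s::finite) option \<Rightarrow> 's fseq \<Rightarrow> 's fseq" where
  "partial i \<mu> f =
     (\<lambda>xs. vector_derivative (\<lambda>t. f (xs[i := xs ! i + t *\<^sub>R axis \<mu> 1])) (at 0))"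

text \<open>\<open>partials [(i\<^sub>1,\<mu>\<^sub>1), \<dots>, (i\<^sub>k,\<mu>\<^sub>k)]\<close> is the iterated partial derivative of order \<open>k\<close>; the
  sequences of length at most \<open>k\<close> play the role of the multi-indices of order at most \<open>k\<close>.\<close>

primrec partials :: "(nat \<times> ('s::finite) option) list \<Rightarrow> 's fseq \<Rightarrow> 's fseq" where
  "partials [] f = f"
| "partials (im # \<alpha>) f = partial (fst im) (snd im) (partials \<alpha> f)"

definition derivs :: "nat \<Rightarrow> (nat \<times> ('s::finite) option) list set" where
  "derivs n = lists ({..<n} \<times> UNIV)"

definition smooth :: "nat \<Rightarrow> ('s::finite) fseq \<Rightarrow> bool" where
  "smooth n f \<longleftrightarrow> (\<forall>\<alpha>\<in>derivs n.
     continuous_on UNIV (\<lambda>x::nat \<Rightarrow> 's spacetime. partials \<alpha> f (map x [0..<n])) \<and>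
     (\<forall>xs i \<mu>. length xs = n \<longrightarrow> i < n \<longrightarrow>
        (\<lambda>t::real. partials \<alpha> f (xs[i := xs ! i + t *\<^sub>R axis \<mu> 1])) differentiable (at 0)))"

definition weighted_derivs :: "nat \<Rightarrow> nat \<Rightarrow> ('s::finite) fseq \<Rightarrow> real set" where
  "weighted_derivs n N f =
     {(1 + list_norm xs) ^ N * cmod (partials \<alpha> f xs) | xs \<alpha>.
        length xs = n \<and> \<alpha> \<in> derivs n \<and> length \<alpha> \<le> N}"

definition schwartz_space :: "nat \<Rightarrow> ('s::finite) fseq set" where
  "schwartz_space n = {f. (\<forall>xs. length xs \<noteq> n \<longrightarrow> f xs = 0) \<and> smooth n f \<and>
     (\<forall>N. bdd_above (weighted_derivs n N f))}"

definition schwartz_norm :: "nat \<Rightarrow> nat \<Rightarrow> ('s::finite) fseq \<Rightarrow> real" where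
  "schwartz_norm n N f = Sup (weighted_derivs n N f)"


section \<open>The Borchers algebra\<close>

definition borchers_space :: "('s::finite) fseq set" where
  "borchers_space = {f. (\<forall>n. component n f \<in> schwartz_space n) \<and>
     (\<exists>N. \<forall>n>N. component n f = 0)}"

definition absolutely_convex :: "('s::finite) fseq set \<Rightarrow> bool" where
  "absolutely_convex C \<longleftrightarrow> (\<forall>f\<in>C. \<forall>g\<in>C. \<forall>a b. cmod a + cmod b \<le> 1 \<longrightarrow>
     scaleB a f + scaleB b g \<in> C)"

text \<open>The locally convex direct sum topology is the finest locally convex topology for which
  all inclusions of the \<^term>\<open>schwartz_space n\<close> are continuous: a neighbourhood base of \<open>0\<close> is given by
  the absolutely convex sets that meet every \<^term>\<open>schwartz_space n\<close> in a neighbourhood of \<open>0\<close>. The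
  norms \<^term>\<open>schwartz_norm n N\<close> increase with \<open>N\<close>, so their balls are a neighbourhood base of
  \<open>0\<close> in \<^term>\<open>schwartz_space n\<close>.\<close>

definition basic_zero_nhd :: "('s::finite) fseq set \<Rightarrow> bool" where
  "basic_zero_nhd C \<longleftrightarrow> C \<subseteq> borchers_space \<and> absolutely_convex C \<and>
     (\<forall>n. \<exists>N. \<exists>\<epsilon>>0. {f \<in> schwartz_space n. schwartz_norm n N f < \<epsilon>} \<subseteq> C)"

definition openB :: "('s::finite) fseq set \<Rightarrow> bool" where
  "openB U \<longleftrightarrow> U \<subseteq> borchers_space \<and>
     (\<forall>f\<in>U. \<exists>C. basic_zero_nhd C \<and> (\<forall>g\<in>C. f + g \<in> U))"

definition borchers_topology :: "('s::finite) fseq topology" where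
  "borchers_topology = topology openB"

lemma partials_lincomb:
  assumes f: "smooth n f" and g: "smooth n g" and h: "\<And>xs. length xs = n \<Longrightarrow> h xs = a * f xs + b * g xs"
  shows "\<alpha> \<in> derivs n \<Longrightarrow> length xs = n \<Longrightarrow>
    partials \<alpha> h xs = a * partials \<alpha> f xs + b * partials \<alpha> g xs"
proof (induction \<alpha> arbitrary: xs)
  case Nil
  then show ?case using h by simp
next
  case (Cons im \<alpha>)
  obtain i \<mu> where im: "im = (i, \<mu>)" by (cases im)
  have \<alpha>: "\<alpha> \<in> derivs n" and i: "i < n"
    using Cons.prems im by (auto simp: derivs_def)
  let ?l = "\<lambda>t::real. xs[i := xs ! i + t *\<^sub>R axis \<mu> 1]"
  have "(\<lambda>t. partials \<alpha> f (?l t)) differentiable (at 0)" "(\<lambda>t. partials \<alpha> g (?l t)) differentiable (at 0)"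
    using f g \<alpha> i Cons.prems unfolding smooth_def by auto
  then have "((\<lambda>t. a * partials \<alpha> f (?l t) + b * partials \<alpha> g (?l t)) has_vector_derivative
      a * partials (im # \<alpha>) f xs + b * partials (im # \<alpha>) g xs) (at 0)"
    unfolding im by (auto simp: partial_def vector_derivative_works
      intro!: has_vector_derivative_add has_vector_derivative_mult_right)
  moreover have "partials \<alpha> h (?l t) = a * partials \<alpha> f (?l t) + b * partials \<alpha> g (?l t)" for t
    using Cons.IH[OF \<alpha>, of "?l t"] Cons.prems by simp
  ultimately show ?case
    by (simp add: im partial_def vector_derivative_at)
qed

lemma smooth_lincomb:
  fixes f g h :: "('s::finite) fseq"
  assumes f: "smooth n f" and g: "smooth n g"
    and h: "\<And>xs. length xs = n \<Longrightarrow> h xs = a * f xs + b * g xs"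
  shows "smooth n h"
  unfolding smooth_def
proof (intro ballI conjI allI impI)
  fix \<alpha> :: "(nat \<times> 's option) list" assume \<alpha>: "\<alpha> \<in> derivs n"
  note eq = partials_lincomb[OF f g h \<alpha>]
  show "continuous_on UNIV (\<lambda>x::nat \<Rightarrow> 's spacetime. partials \<alpha> h (map x [0..<n]))"
    using f g \<alpha> by (auto simp: eq smooth_def intro!: continuous_intros)
  fix xs :: "'s spacetime list" and i \<mu> assume "length xs = n" "i < n"
  then show "(\<lambda>t::real. partials \<alpha> h (xs[i := xs ! i + t *\<^sub>R axis \<mu> 1])) differentiable (at 0)"
    using f g \<alpha> by (auto simp: eq smooth_def intro!: derivative_intros)
qed

lemma schwartz_space_lincomb:
  fixes f g :: "('s::finite) fseq"
  assumes f: "f \<in> schwartz_space n" and g: "g \<in> schwartz_space n"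
  shows "scaleB a f + scaleB b g \<in> schwartz_space n"
proof -
  let ?h = "scaleB a f + scaleB b g"
  have h: "?h xs = a * f xs + b * g xs" for xs
    by (simp add: scaleB_def)
  have s: "smooth n f" "smooth n g"
    using f g by (auto simp: schwartz_space_def)
  have "bdd_above (weighted_derivs n N ?h)" for N
  proof -
    obtain A B where A: "\<And>y. y \<in> weighted_derivs n N f \<Longrightarrow> y \<le> A"
      and B: "\<And>y. y \<in> weighted_derivs n N g \<Longrightarrow> y \<le> B"
      using f g unfolding schwartz_space_def bdd_above_def by blast
    have "y \<le> cmod a * A + cmod b * B" if y: "y \<in> weighted_derivs n N ?h" for y
    proof -
      obtain xs \<alpha> where xs: "length xs = n" and \<alpha>: "\<alpha> \<in> derivs n" "length \<alpha> \<le> N"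
        and y: "y = (1 + list_norm xs) ^ N * cmod (partials \<alpha> ?h xs)"
        using y unfolding weighted_derivs_def by blast
      let ?w = "(1 + list_norm xs) ^ N"
      have w: "?w \<ge> 0"
        by (auto simp: list_norm_def intro!: zero_le_power add_nonneg_nonneg sum_list_nonneg)
      have "y \<le> ?w * (cmod a * cmod (partials \<alpha> f xs) + cmod b * cmod (partials \<alpha> g xs))"
        unfolding y partials_lincomb[OF s h \<alpha>(1) xs]
        by (intro mult_left_mono w) (metis norm_mult norm_triangle_ineq)
      also have "\<dots> = cmod a * (?w * cmod (partials \<alpha> f xs)) + cmod b * (?w * cmod (partials \<alpha> g xs))"
        by (simp add: algebra_simps)
      also have "\<dots> \<le> cmod a * A + cmod b * B"
        using xs \<alpha> by (intro add_mono mult_left_mono A B) (auto simp: weighted_derivs_def)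
      finally show ?thesis .
    qed
    then show ?thesis by (auto simp: bdd_above_def)
  qed
  moreover have "?h xs = 0" if "length xs \<noteq> n" for xs
    unfolding h using f g that by (simp add: schwartz_space_def)
  ultimately show ?thesis
    using smooth_lincomb[OF s, of ?h a b] h unfolding schwartz_space_def by blast
qed

lemma component_lincomb:
  "component n (scaleB a f + scaleB b g) = scaleB a (component n f) + scaleB b (component n g)"
  by (auto simp: component_def scaleB_def)

lemma borchers_space_lincomb:
  assumes "f \<in> borchers_space" "g \<in> borchers_space"
  shows "scaleB a f + scaleB b g \<in> borchers_space"
proof -
  obtain M N where "\<And>n. n > M \<Longrightarrow> component n f = 0" "\<And>n. n > N \<Longrightarrow> component n g = 0"
    using assms unfolding borchers_space_def by blast
  then have "component n (scaleB a f + scaleB b g) = 0" if "n > max M N" for n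
    using that unfolding component_lincomb by (simp add: scaleB_def) (simp add: plus_fun_def zero_fun_def)
  then have "\<exists>N. \<forall>n>N. component n (scaleB a f + scaleB b g) = 0"
    by blast
  moreover have "component n (scaleB a f + scaleB b g) \<in> schwartz_space n" for n
    using assms by (simp add: borchers_space_def component_lincomb schwartz_space_lincomb)
  ultimately show ?thesis
    by (simp add: borchers_space_def)
qed

lemma partials_zero: "partials \<alpha> (\<lambda>_. 0) = (\<lambda>_. 0)"
  by (induction \<alpha>) (auto simp: partial_def)

lemma zero_schwartz_space: "0 \<in> schwartz_space n"
proof -
  have "weighted_derivs n N 0 \<subseteq> {0::real}" for N
    by (auto simp: weighted_derivs_def zero_fun_def partials_zero)
  then have "bdd_above (weighted_derivs n N 0)" for N
    by (meson bdd_above_mono bdd_above_finite finite.intros)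
  then show ?thesis
    by (auto simp: schwartz_space_def smooth_def zero_fun_def partials_zero)
qed

lemma schwartz_subset_borchers: "schwartz_space n \<subseteq> borchers_space"
proof
  fix f :: "'s::finite fseq" assume f: "f \<in> schwartz_space n"
  have "component m f = (if m = n then f else 0)" for m
    using f by (auto simp: component_def schwartz_space_def fun_eq_iff)
  then show "f \<in> borchers_space"
    using f zero_schwartz_space by (auto simp: borchers_space_def intro!: exI[of _ n])
qed

lemma schwartz_norm_mono:
  fixes f :: "('s::finite) fseq"
  assumes f: "f \<in> schwartz_space n" and "M \<le> N"
  shows "schwartz_norm n M f \<le> schwartz_norm n N f"
  unfolding schwartz_norm_def
proof (rule cSup_least)
  show "weighted_derivs n M f \<noteq> {}"
  proof -
    let ?xs = "replicate n 0 :: 's spacetime list"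
    have "(1 + list_norm ?xs) ^ M * cmod (partials [] f ?xs) \<in> weighted_derivs n M f"
      unfolding weighted_derivs_def derivs_def
      by (intro CollectI exI[of _ ?xs] exI[of _ "[]"]) auto
    then show ?thesis by blast
  qed
  fix y assume "y \<in> weighted_derivs n M f"
  then obtain xs \<alpha> where xs: "length xs = n" "\<alpha> \<in> derivs n" "length \<alpha> \<le> M"
    and y: "y = (1 + list_norm xs) ^ M * cmod (partials \<alpha> f xs)"
    unfolding weighted_derivs_def by blast
  have "list_norm xs \<ge> 0"
    by (auto simp: list_norm_def intro!: sum_list_nonneg)
  then have "y \<le> (1 + list_norm xs) ^ N * cmod (partials \<alpha> f xs)"
    unfolding y using \<open>M \<le> N\<close> by (intro mult_right_mono power_increasing) auto
  also have "\<dots> \<le> Sup (weighted_derivs n N f)"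
    using f xs \<open>M \<le> N\<close>
    by (intro cSup_upper) (auto simp: schwartz_space_def weighted_derivs_def intro!: exI[of _ xs] exI[of _ \<alpha>])
  finally show "y \<le> Sup (weighted_derivs n N f)" .
qed

lemma basic_zero_nhd_Int:
  fixes C D :: "('s::finite) fseq set"
  assumes "basic_zero_nhd C" "basic_zero_nhd D"
  shows "basic_zero_nhd (C \<inter> D)"
proof -
  have "\<exists>N. \<exists>\<epsilon>>0. {f \<in> schwartz_space n. schwartz_norm n N f < \<epsilon>} \<subseteq> C \<inter> D" for n
  proof -
    obtain M \<delta> where M: "\<delta> > 0" "{f \<in> schwartz_space n. schwartz_norm n M f < \<delta>} \<subseteq> C"
      using assms(1) unfolding basic_zero_nhd_def by blast
    obtain N \<epsilon> where N: "\<epsilon> > 0" "{f \<in> schwartz_space n. schwartz_norm n N f < \<epsilon>} \<subseteq> D"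
      using assms(2) unfolding basic_zero_nhd_def by blast
    have mono: "schwartz_norm n M f \<le> schwartz_norm n (max M N) f"
      "schwartz_norm n N f \<le> schwartz_norm n (max M N) f" if "f \<in> schwartz_space n" for f :: "'s fseq"
      using that by (auto intro: schwartz_norm_mono)
    have "f \<in> C \<and> f \<in> D"
      if "f \<in> schwartz_space n" "schwartz_norm n (max M N) f < min \<delta> \<epsilon>" for f
      using that mono[OF that(1)] by (intro conjI subsetD[OF M(2)] subsetD[OF N(2)]) simp_all
    then have "{f \<in> schwartz_space n. schwartz_norm n (max M N) f < min \<delta> \<epsilon>} \<subseteq> C \<inter> D"
      by blast
    then show ?thesis
      using M(1) N(1) by (intro exI[of _ "max M N"] exI[of _ "min \<delta> \<epsilon>"]) simp
  qed
  then show ?thesis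
    using assms unfolding basic_zero_nhd_def absolutely_convex_def by auto
qed

lemma istopology_openB: "istopology openB"
  unfolding istopology_def
proof (intro conjI allI impI)
  fix S T :: "'s::finite fseq set" assume ST: "openB S" "openB T"
  show "openB (S \<inter> T)"
    unfolding openB_def
  proof (intro conjI ballI)
    show "S \<inter> T \<subseteq> borchers_space" using ST by (auto simp: openB_def)
    fix f assume "f \<in> S \<inter> T"
    then have "f \<in> S" "f \<in> T" by auto
    then obtain C D where "basic_zero_nhd C" "\<forall>g\<in>C. f + g \<in> S" "basic_zero_nhd D" "\<forall>g\<in>D. f + g \<in> T"
      using ST unfolding openB_def by meson
    then show "\<exists>C. basic_zero_nhd C \<and> (\<forall>g\<in>C. f + g \<in> S \<inter> T)"
      by (intro exI[of _ "C \<inter> D"]) (auto intro: basic_zero_nhd_Int)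
  qed
next
  fix \<K> :: "'s::finite fseq set set" assume \<K>: "\<forall>K\<in>\<K>. openB K"
  show "openB (\<Union>\<K>)"
    unfolding openB_def
  proof (intro conjI ballI)
    show "\<Union>\<K> \<subseteq> borchers_space" using \<K> by (auto simp: openB_def)
    fix f assume "f \<in> \<Union>\<K>"
    then obtain K where "K \<in> \<K>" "f \<in> K" by blast
    then obtain C where "basic_zero_nhd C" "\<forall>g\<in>C. f + g \<in> K"
      using \<K> unfolding openB_def by meson
    with \<open>K \<in> \<K>\<close> show "\<exists>C. basic_zero_nhd C \<and> (\<forall>g\<in>C. f + g \<in> \<Union>\<K>)"
      by blast
  qed
qed

lemma openin_borchers_topology: "openin borchers_topology U \<longleftrightarrow> openB U"
  by (simp add: borchers_topology_def istopology_openB)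

lemma topspace_borchers_topology: "topspace borchers_topology = borchers_space"
proof -
  have "basic_zero_nhd (borchers_space :: 's::finite fseq set)"
    unfolding basic_zero_nhd_def absolutely_convex_def
    by (intro conjI ballI allI impI borchers_space_lincomb exI[of _ "1::real"] exI[of _ 0])
      (auto intro: subsetD[OF schwartz_subset_borchers])
  moreover have "f + g \<in> borchers_space" if "f \<in> borchers_space" "g \<in> borchers_space"
    for f g :: "'s::finite fseq"
    using borchers_space_lincomb[OF that, of 1 1] by (simp add: scaleB_def)
  ultimately have "openB (borchers_space :: 's::finite fseq set)"
    unfolding openB_def by (intro conjI ballI exI[of _ borchers_space]) auto
  then show ?thesis
    unfolding topspace_def openin_borchers_topology
    by (intro equalityI Union_least Union_upper) (simp_all add: openB_def)
qed

definition tensor :: "('s::finite) fseq \<Rightarrow> 's fseq \<Rightarrow> 's fseq"  (infixl "\<otimes>\<^sub>B" 70) where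
  "f \<otimes>\<^sub>B h = (\<lambda>xs. \<Sum>j\<le>length xs. f (take j xs) * h (drop j xs))"

definition unitB :: "('s::finite) fseq" where
  "unitB = (\<lambda>xs. if xs = [] then 1 else 0)"

definition starB :: "('s::finite) fseq \<Rightarrow> 's fseq" where
  "starB f = (\<lambda>xs. cnj (f (rev xs)))"

definition poincare :: "real ^ ('s::finite) option ^ 's option \<Rightarrow> 's spacetime \<Rightarrow> 's fseq \<Rightarrow> 's fseq" where
  "poincare \<Lambda> a f = (\<lambda>xs. f (map (\<lambda>x. matrix_inv \<Lambda> *v (x - a)) xs))"

definition subspaceB :: "('s::finite) fseq set \<Rightarrow> bool" where
  "subspaceB J \<longleftrightarrow> J \<subseteq> borchers_space \<and> 0 \<in> J \<and> (\<forall>f\<in>J. \<forall>g\<in>J. f + g \<in> J) \<and>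
     (\<forall>f\<in>J. \<forall>c. scaleB c f \<in> J)"

definition left_idealB :: "('s::finite) fseq set \<Rightarrow> bool" where
  "left_idealB J \<longleftrightarrow> subspaceB J \<and> (\<forall>f\<in>borchers_space. \<forall>g\<in>J. f \<otimes>\<^sub>B g \<in> J)"

definition two_sided_idealB :: "('s::finite) fseq set \<Rightarrow> bool" where
  "two_sided_idealB J \<longleftrightarrow> left_idealB J \<and> (\<forall>f\<in>borchers_space. \<forall>g\<in>J. g \<otimes>\<^sub>B f \<in> J)"

definition support1 :: "('s::finite) fseq \<Rightarrow> 's spacetime set" where
  "support1 h = closure {x. h [x] \<noteq> 0}"

definition fourier1 :: "('s::finite) fseq \<Rightarrow> 's spacetime \<Rightarrow> complex" where
  "fourier1 h k = integral\<^sup>L lborel (\<lambda>a. exp (\<i> * complex_of_real (mdot k a)) * h [a])"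

text \<open>The vector-valued integral of \<open>a \<mapsto> h(a) \<alpha>\<^bsub>{1,a}\<^esub>(f)\<close>, evaluated pointwise.\<close>

definition smear :: "('s::finite) fseq \<Rightarrow> 's fseq \<Rightarrow> 's fseq" where
  "smear f h = (\<lambda>xs. integral\<^sup>L lborel (\<lambda>a. poincare (mat 1) a f xs * h [a]))"

definition spectral_ideal :: "('s::finite) fseq set" where
  "spectral_ideal = left_idealB hull
     {smear f h | f h. f \<in> borchers_space \<and> h \<in> schwartz_space 1 \<and>
        closure {k. fourier1 h k \<noteq> 0} \<inter> closed_forward_cone = {}}"

definition locality_ideal :: "('s::finite) fseq set" where
  "locality_ideal = two_sided_idealB hull
     {f \<otimes>\<^sub>B h - h \<otimes>\<^sub>B f | f h. f \<in> schwartz_space 1 \<and> h \<in> schwartz_space 1 \<and>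
        (\<forall>x\<in>support1 f. \<forall>y\<in>support1 h. spacelike (x - y))}"


section \<open>Complex linear algebra and Hilbert spaces\<close>

text \<open>Sesquilinear forms are antilinear in the first argument.\<close>

definition sesquilinear_on ::
    "'v::ab_group_add set \<Rightarrow> (complex \<Rightarrow> 'v \<Rightarrow> 'v) \<Rightarrow> ('v \<Rightarrow> 'v \<Rightarrow> complex) \<Rightarrow> bool" where
  "sesquilinear_on V s B \<longleftrightarrow>
     (\<forall>u\<in>V. \<forall>v\<in>V. \<forall>w\<in>V. B (u + v) w = B u w + B v w \<and> B u (v + w) = B u v + B u w) \<and>
     (\<forall>u\<in>V. \<forall>v\<in>V. \<forall>c. B (s c u) v = cnj c * B u v \<and> B u (s c v) = c * B u v)"

definition psd_on :: "'v set \<Rightarrow> ('v \<Rightarrow> 'v \<Rightarrow> complex) \<Rightarrow> bool" where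
  "psd_on V B \<longleftrightarrow> (\<forall>v\<in>V. Im (B v v) = 0 \<and> Re (B v v) \<ge> 0)"

definition linear_between ::
    "'v::ab_group_add set \<Rightarrow> (complex \<Rightarrow> 'v \<Rightarrow> 'v) \<Rightarrow> 'w::ab_group_add set \<Rightarrow>
     (complex \<Rightarrow> 'w \<Rightarrow> 'w) \<Rightarrow> ('v \<Rightarrow> 'w) \<Rightarrow> bool" where
  "linear_between V s W t T \<longleftrightarrow> T \<in> V \<rightarrow> W \<and> (\<forall>u\<in>V. \<forall>v\<in>V. T (u + v) = T u + T v) \<and>
     (\<forall>v\<in>V. \<forall>c. T (s c v) = t c (T v))"

text \<open>A Hilbert space lives on a linear subspace \<open>carr\<close> of an ambient vector space, because
  the spaces below depend on a functional and therefore cannot be types.\<close>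

record 'h hspace =
  carr :: "'h set"
  smul :: "complex \<Rightarrow> 'h \<Rightarrow> 'h"
  ip :: "'h \<Rightarrow> 'h \<Rightarrow> complex"

definition hnorm :: "'h hspace \<Rightarrow> 'h \<Rightarrow> real" where
  "hnorm H v = sqrt (Re (ip H v v))"

definition hilbert_space :: "'h::ab_group_add hspace \<Rightarrow> bool" where
  "hilbert_space H \<longleftrightarrow>
     vector_space (smul H) \<and> module.subspace (smul H) (carr H) \<and>
     sesquilinear_on (carr H) (smul H) (ip H) \<and>
     (\<forall>u\<in>carr H. \<forall>v\<in>carr H. ip H v u = cnj (ip H u v)) \<and>
     psd_on (carr H) (ip H) \<and> (\<forall>v\<in>carr H. ip H v v = 0 \<longrightarrow> v = 0) \<and>
     (\<forall>X::nat \<Rightarrow> 'h. (\<forall>n. X n \<in> carr H) \<longrightarrow>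
        (\<forall>e>0. \<exists>M. \<forall>m\<ge>M. \<forall>n\<ge>M. hnorm H (X m - X n) < e) \<longrightarrow>
        (\<exists>l\<in>carr H. (\<lambda>n. hnorm H (X n - l)) \<longlonglongrightarrow> 0))"

definition dense_in :: "'h::ab_group_add hspace \<Rightarrow> 'h set \<Rightarrow> bool" where
  "dense_in H A \<longleftrightarrow> A \<subseteq> carr H \<and> (\<forall>v\<in>carr H. \<forall>e>0. \<exists>a\<in>A. hnorm H (v - a) < e)"

definition bounded_operator :: "'h::ab_group_add hspace \<Rightarrow> ('h \<Rightarrow> 'h) \<Rightarrow> bool" where
  "bounded_operator H T \<longleftrightarrow> linear_between (carr H) (smul H) (carr H) (smul H) T \<and>
     (\<exists>c. \<forall>v\<in>carr H. hnorm H (T v) \<le> c * hnorm H v)"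

definition self_adjoint :: "'h::ab_group_add hspace \<Rightarrow> ('h \<Rightarrow> 'h) \<Rightarrow> bool" where
  "self_adjoint H T \<longleftrightarrow> bounded_operator H T \<and>
     (\<forall>u\<in>carr H. \<forall>v\<in>carr H. ip H u (T v) = ip H (T u) v)"

definition positive_operator :: "'h::ab_group_add hspace \<Rightarrow> ('h \<Rightarrow> 'h) \<Rightarrow> bool" where
  "positive_operator H T \<longleftrightarrow> self_adjoint H T \<and> psd_on (carr H) (\<lambda>u v. ip H u (T v))"

text \<open>For self-adjoint \<open>T\<close>, \<open>|T|\<close> is the positive square root of \<open>T\<^sup>*T = T\<^sup>2\<close>; for injective \<open>T\<close>,
  the range of \<open>|T|\<close> is dense and \<open>sign(T)\<close> is the bounded operator given by the polar
  decomposition \<open>T = sign(T) |T|\<close>.\<close>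

definition is_operator_abs :: "'h::ab_group_add hspace \<Rightarrow> ('h \<Rightarrow> 'h) \<Rightarrow> ('h \<Rightarrow> 'h) \<Rightarrow> bool" where
  "is_operator_abs H T A \<longleftrightarrow> positive_operator H A \<and> (\<forall>v\<in>carr H. A (A v) = T (T v))"

definition is_operator_sign ::
    "'h::ab_group_add hspace \<Rightarrow> ('h \<Rightarrow> 'h) \<Rightarrow> ('h \<Rightarrow> 'h) \<Rightarrow> ('h \<Rightarrow> 'h) \<Rightarrow> bool" where
  "is_operator_sign H T A S \<longleftrightarrow> bounded_operator H S \<and> (\<forall>v\<in>carr H. S (A v) = T v)"

definition is_quotient_map ::
    "'a::ab_group_add hspace \<Rightarrow> 'a set \<Rightarrow> 'b::ab_group_add hspace \<Rightarrow> ('a \<Rightarrow> 'b) \<Rightarrow> bool" where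
  "is_quotient_map H K Q q \<longleftrightarrow> linear_between (carr H) (smul H) (carr Q) (smul Q) q \<and>
     q ` carr H = carr Q \<and> {v \<in> carr H. q v = 0} = K \<and>
     (\<forall>v\<in>carr H. hnorm Q (q v) = (INF k\<in>K. hnorm H (v - k)))"


section \<open>The axioms for \<open>W\<close>\<close>

definition hilbert_seminorm :: "(('s::finite) fseq \<Rightarrow> real) \<Rightarrow> bool" where
  "hilbert_seminorm p \<longleftrightarrow> (\<exists>B. sesquilinear_on borchers_space scaleB B \<and>
     psd_on borchers_space B \<and> (\<forall>f\<in>borchers_space. p f = sqrt (Re (B f f))))"

definition in_dual :: "(('s::finite) fseq \<Rightarrow> complex) \<Rightarrow> bool" where
  "in_dual W \<longleftrightarrow> linear_between borchers_space scaleB UNIV (*) W \<and>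
     continuous_map borchers_topology euclidean W"

definition poincare_invariant :: "(('s::finite) fseq \<Rightarrow> complex) \<Rightarrow> bool" where
  "poincare_invariant W \<longleftrightarrow> (\<forall>\<Lambda> a. proper_orthochronous \<Lambda> \<longrightarrow>
     (\<forall>f\<in>borchers_space. W (poincare \<Lambda> a f) = W f))"

definition spectral_condition :: "(('s::finite) fseq \<Rightarrow> complex) \<Rightarrow> bool" where
  "spectral_condition W \<longleftrightarrow> (\<forall>f\<in>spectral_ideal. W f = 0)"

definition local_functional :: "(('s::finite) fseq \<Rightarrow> complex) \<Rightarrow> bool" where
  "local_functional W \<longleftrightarrow> (\<forall>f\<in>locality_ideal. W f = 0)"

definition hilbert_structure_condition ::
    "(('s::finite) fseq \<Rightarrow> complex) \<Rightarrow> ('s fseq \<Rightarrow> real) \<Rightarrow> bool" where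
  "hilbert_structure_condition W p \<longleftrightarrow> hilbert_seminorm p \<and>
     (\<forall>f\<in>borchers_space. \<forall>g\<in>borchers_space. cmod (W (starB f \<otimes>\<^sub>B g)) \<le> p f * p g)"

definition cluster_property :: "(('s::finite) fseq \<Rightarrow> complex) \<Rightarrow> bool" where
  "cluster_property W \<longleftrightarrow> (\<forall>f\<in>borchers_space. \<forall>g\<in>borchers_space. \<forall>a. spacelike a \<longrightarrow>
     ((\<lambda>t::real. W (f \<otimes>\<^sub>B poincare (mat 1) (t *\<^sub>R a) g)) \<longlongrightarrow> W f * W g) at_top)"

definition hermitian_functional :: "(('s::finite) fseq \<Rightarrow> complex) \<Rightarrow> bool" where
  "hermitian_functional W \<longleftrightarrow> (\<forall>f\<in>borchers_space. W (starB f) = cnj (W f))"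

definition sobolev_dominated :: "(('s::finite) fseq \<Rightarrow> real) \<Rightarrow> bool" where
  "sobolev_dominated p \<longleftrightarrow> continuous_map borchers_topology euclideanreal p"


section \<open>The associated Krein space representation\<close>

text \<open>The Sobolev Hilbert norm of differentiability order \<open>K\<close> and polynomial weight \<open>L\<close>:
  \<open>\<Sum>\<^bsub>|\<alpha>| \<le> K\<^esub> \<integral> (1 + |x|\<^sup>2)\<^sup>L |\<partial>\<^sup>\<alpha> f(x)|\<^sup>2 dx\<close> is its square. For \<open>n = 0\<close> it is \<open>|f\<^sub>0|\<close>.\<close>

definition sobolev_norm :: "nat \<Rightarrow> nat \<Rightarrow> nat \<Rightarrow> ('s::finite) fseq \<Rightarrow> real" where
  "sobolev_norm n K L f = sqrt (\<Sum>\<alpha>\<in>{\<alpha>\<in>derivs n. length \<alpha> \<le> K}.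
     integral\<^sup>L (Pi\<^sub>M {..<n} (\<lambda>_. lborel)) (\<lambda>x.
       (1 + (list_norm (map x [0..<n]))\<^sup>2) ^ L * (cmod (partials \<alpha> f (map x [0..<n])))\<^sup>2))"

definition sobolev_direct_sum_norm :: "(('s::finite) fseq \<Rightarrow> real) \<Rightarrow> bool" where
  "sobolev_direct_sum_norm p\<^sub>1 \<longleftrightarrow> (\<exists>K L :: nat \<Rightarrow> nat. \<forall>f\<in>borchers_space.
     p\<^sub>1 f = sqrt (\<Sum>n\<in>{n. component n f \<noteq> 0}. (sobolev_norm n (K n) (L n) (component n f))\<^sup>2))"

definition adjusted_norm :: "(('s::finite) fseq \<Rightarrow> real) \<Rightarrow> ('s fseq \<Rightarrow> real) \<Rightarrow> 's fseq \<Rightarrow> real" where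
  "adjusted_norm p p\<^sub>1 = (if \<forall>f\<in>borchers_space. p f = 0 \<longrightarrow> f = 0 then p
     else (\<lambda>f. sqrt ((p f)\<^sup>2 + (p\<^sub>1 f)\<^sup>2)))"

definition state :: "('s fseq \<Rightarrow> 'a) \<Rightarrow> ('a \<Rightarrow> 'b) \<Rightarrow> ('b \<Rightarrow> 'h) \<Rightarrow> ('s::finite) fseq \<Rightarrow> 'h" where
  "state \<iota> q j f = j (q (\<iota> f))"

text \<open>The completions and the quotient are given by arbitrary realisations: \<open>\<iota>\<close> embeds the
  Borchers algebra into its completion \<open>H\<^sub>1\<close>, \<open>q\<close> is the quotient map \<open>H\<^sub>1 \<rightarrow> H\<^sub>2\<close> (so
  \<open>\<pi>(f) = q (\<iota> f)\<close>), and \<open>j\<close> embeds \<open>H\<^sub>2\<close> with the scalar product \<open>(\<cdot>, |\<eta>\<^sub>2| \<cdot>)\<^sub>2\<close> into \<open>H\<close>. As the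
  domain \<open>D\<close> is dense in \<open>H\<^sub>2\<close> and \<open>|\<eta>\<^sub>2|\<close> is bounded, the completion \<open>H\<close> of \<open>D\<close> contains all of
  \<open>H\<^sub>2\<close>; this is needed for \<open>sign(\<eta>\<^sub>2)\<close>, which need not leave \<open>D\<close> invariant, to extend to \<open>H\<close>. A
  vector \<open>\<pi>(f)\<close> of \<open>D\<close>, regarded as an element of \<open>H\<close>, is \<open>state \<iota> q j f\<close>.\<close>

locale krein_space_construction =
  fixes W :: "('s::finite) fseq \<Rightarrow> complex"
    and p p\<^sub>1 :: "'s fseq \<Rightarrow> real"
    and H\<^sub>1 :: "'a::ab_group_add hspace" and \<iota> :: "'s fseq \<Rightarrow> 'a"
    and form :: "'a \<Rightarrow> 'a \<Rightarrow> complex"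
    and H\<^sub>2 :: "'b::ab_group_add hspace" and q :: "'a \<Rightarrow> 'b"
    and \<eta>\<^sub>2 abs_\<eta>\<^sub>2 sign_\<eta>\<^sub>2 :: "'b \<Rightarrow> 'b"
    and H :: "'h::ab_group_add hspace" and j :: "'b \<Rightarrow> 'h"
    and \<eta> :: "'h \<Rightarrow> 'h"
  assumes p\<^sub>1: "sobolev_direct_sum_norm p\<^sub>1"
    and H\<^sub>1: "hilbert_space H\<^sub>1"
    and \<iota>_linear: "linear_between borchers_space scaleB (carr H\<^sub>1) (smul H\<^sub>1) \<iota>"
    and \<iota>_norm: "\<And>f. f \<in> borchers_space \<Longrightarrow> hnorm H\<^sub>1 (\<iota> f) = adjusted_norm p p\<^sub>1 f"
    and \<iota>_dense: "dense_in H\<^sub>1 (\<iota> ` borchers_space)"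
    and form_sesquilinear: "sesquilinear_on (carr H\<^sub>1) (smul H\<^sub>1) form"
    and form_continuous:
      "\<exists>c. \<forall>u\<in>carr H\<^sub>1. \<forall>v\<in>carr H\<^sub>1. cmod (form u v) \<le> c * hnorm H\<^sub>1 u * hnorm H\<^sub>1 v"
    and form_extends: "\<And>f g. f \<in> borchers_space \<Longrightarrow> g \<in> borchers_space \<Longrightarrow>
      form (\<iota> f) (\<iota> g) = W (starB f \<otimes>\<^sub>B g)"
    and H\<^sub>2: "hilbert_space H\<^sub>2"
    and q: "is_quotient_map H\<^sub>1 {v \<in> carr H\<^sub>1. \<forall>w\<in>carr H\<^sub>1. form w v = 0} H\<^sub>2 q"
    and \<eta>\<^sub>2_self_adjoint: "self_adjoint H\<^sub>2 \<eta>\<^sub>2"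
    and \<eta>\<^sub>2_inj: "inj_on \<eta>\<^sub>2 (carr H\<^sub>2)"
    and \<eta>\<^sub>2_contraction: "\<And>v. v \<in> carr H\<^sub>2 \<Longrightarrow> hnorm H\<^sub>2 (\<eta>\<^sub>2 v) \<le> hnorm H\<^sub>2 v"
    and \<eta>\<^sub>2_form: "\<And>u v. u \<in> carr H\<^sub>1 \<Longrightarrow> v \<in> carr H\<^sub>1 \<Longrightarrow> form u v = ip H\<^sub>2 (q u) (\<eta>\<^sub>2 (q v))"
    and abs_\<eta>\<^sub>2: "is_operator_abs H\<^sub>2 \<eta>\<^sub>2 abs_\<eta>\<^sub>2"
    and sign_\<eta>\<^sub>2: "is_operator_sign H\<^sub>2 \<eta>\<^sub>2 abs_\<eta>\<^sub>2 sign_\<eta>\<^sub>2"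
    and H: "hilbert_space H"
    and j_linear: "linear_between (carr H\<^sub>2) (smul H\<^sub>2) (carr H) (smul H) j"
    and j_isometric: "\<And>u v. u \<in> carr H\<^sub>2 \<Longrightarrow> v \<in> carr H\<^sub>2 \<Longrightarrow> ip H (j u) (j v) = ip H\<^sub>2 u (abs_\<eta>\<^sub>2 v)"
    and j_dense: "dense_in H (j ` q ` \<iota> ` borchers_space)"
    and \<eta>_bounded: "bounded_operator H \<eta>"
    and \<eta>_extends: "\<And>v. v \<in> carr H\<^sub>2 \<Longrightarrow> \<eta> (j v) = j (sign_\<eta>\<^sub>2 v)"

text \<open>A topologically equivalent scalar product and its metric operator, for the same
  indefinite form and such that the vacuum vector is fixed by the metric operator.\<close>

definition vacuum_adapted ::
    "'h::ab_group_add hspace \<Rightarrow> ('h \<Rightarrow> 'h) \<Rightarrow> 'h \<Rightarrow> 'h hspace \<Rightarrow> ('h \<Rightarrow> 'h) \<Rightarrow> bool" where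
  "vacuum_adapted H \<eta> \<Omega> H' \<eta>' \<longleftrightarrow>
     hilbert_space H' \<and> carr H' = carr H \<and> smul H' = smul H \<and>
     (\<exists>c>0. \<exists>C>0. \<forall>v\<in>carr H. c * hnorm H v \<le> hnorm H' v \<and> hnorm H' v \<le> C * hnorm H v) \<and>
     self_adjoint H' \<eta>' \<and> (\<forall>v\<in>carr H. \<eta>' (\<eta>' v) = v) \<and>
     (\<forall>u\<in>carr H. \<forall>v\<in>carr H. ip H' u (\<eta>' v) = ip H u (\<eta> v)) \<and> \<eta>' \<Omega> = \<Omega>"

text \<open>\<open>\<phi>(f)\<close> acts on \<open>D = state \<iota> q j ` borchers_space\<close>. The Krein space is \<open>K\<close> with metric operator
  \<open>\<theta>\<close>: either \<open>H\<close> and \<open>\<eta>\<close> themselves or a vacuum-adapted variant.\<close>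

locale krein_space_representation =
  krein_space_construction W p p\<^sub>1 H\<^sub>1 \<iota> form H\<^sub>2 q \<eta>\<^sub>2 abs_\<eta>\<^sub>2 sign_\<eta>\<^sub>2 H j \<eta>
  for W :: "('s::finite) fseq \<Rightarrow> complex"
    and p p\<^sub>1 :: "'s fseq \<Rightarrow> real"
    and H\<^sub>1 :: "'a::ab_group_add hspace" and \<iota> :: "'s fseq \<Rightarrow> 'a"
    and form :: "'a \<Rightarrow> 'a \<Rightarrow> complex"
    and H\<^sub>2 :: "'b::ab_group_add hspace" and q :: "'a \<Rightarrow> 'b"
    and \<eta>\<^sub>2 abs_\<eta>\<^sub>2 sign_\<eta>\<^sub>2 :: "'b \<Rightarrow> 'b"
    and H :: "'h::ab_group_add hspace" and j :: "'b \<Rightarrow> 'h"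
    and \<eta> :: "'h \<Rightarrow> 'h" +
  fixes K :: "'h hspace" and \<theta> :: "'h \<Rightarrow> 'h" and \<Omega> :: 'h and \<phi> :: "'s fseq \<Rightarrow> 'h \<Rightarrow> 'h"
  assumes \<Omega>: "\<Omega> = state \<iota> q j unitB"
    and \<phi>: "\<And>f g. f \<in> borchers_space \<Longrightarrow> g \<in> borchers_space \<Longrightarrow>
      \<phi> f (state \<iota> q j g) = state \<iota> q j (f \<otimes>\<^sub>B g)"
    and krein_space: "K = H \<and> \<theta> = \<eta> \<or> vacuum_adapted H \<eta> \<Omega> K \<theta>"

end

theory Submission
  imports Defs "HOL-Probability.Sinc_Integral"
begin

text \<open>Since \<open>\<phi>(f)\<Omega> = \<pi>(f \<otimes> \<one>) = \<pi>(f)\<close>, the norm of \<open>\<phi>(f)\<Omega>\<close> has to be controlled by that of \<open>f\<close>. The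
  quotient map \<open>H\<^sub>1 \<rightarrow> H\<^sub>2\<close> is a contraction, and so is the passage to \<open>(\<cdot>, |\<eta>\<^sub>2| \<cdot>)\<^sub>2\<close>, as \<open>|\<eta>\<^sub>2|\<close> inherits
  the contraction bound of \<open>\<eta>\<^sub>2\<close>; a vacuum-adapted norm is equivalent. It remains to see that
  \<open>\<surd>(p\<^sup>2 + p\<^sub>1\<^sup>2)\<close> is continuous at \<open>0\<close>: for \<open>p\<close> this is Sobolev domination, and \<open>p\<^sub>1\<close> is bounded by a
  weighted sum of Schwartz norms because \<open>(1 + |x|)\<^sup>-\<^sup>2\<^sup>d\<^sup>n\<close> is integrable over \<open>\<real>\<^sup>d\<^sup>n\<close>.\<close>

section \<open>Sobolev norms and Schwartz norms\<close>

lemma list_norm_nonneg: "0 \<le> list_norm xs"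
  by (auto simp: list_norm_def intro!: sum_list_nonneg)

lemma norm_nth_le_list_norm:
  assumes "i < length xs"
  shows "norm (xs ! i) \<le> list_norm xs"
proof -
  have "(norm (xs ! i))\<^sup>2 \<le> (\<Sum>x\<leftarrow>xs. (norm x)\<^sup>2)"
    using assms by (intro member_le_sum_list) auto
  then show ?thesis
    unfolding list_norm_def by (rule real_le_rsqrt)
qed

lemma weighted_derivs_nonneg: "y \<in> weighted_derivs n N f \<Longrightarrow> 0 \<le> y"
  by (auto simp: weighted_derivs_def list_norm_nonneg)

text \<open>A supremum of reals can be bounded above only over a nonempty set; the origin with the
  empty multi-index is always available.\<close>

lemma weighted_derivs_nonempty:
  fixes f :: "('s::finite) fseq"
  shows "weighted_derivs n N f \<noteq> {}"
proof -
  let ?xs = "replicate n 0 :: 's spacetime list"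
  have "(1 + list_norm ?xs) ^ N * cmod (partials [] f ?xs) \<in> weighted_derivs n N f"
    unfolding weighted_derivs_def derivs_def
    by (intro CollectI exI[of _ ?xs] exI[of _ "[]"]) auto
  then show ?thesis by blast
qed

lemma schwartz_norm_upper:
  assumes "f \<in> schwartz_space n" "length xs = n" "\<alpha> \<in> derivs n" "length \<alpha> \<le> N"
  shows "(1 + list_norm xs) ^ N * cmod (partials \<alpha> f xs) \<le> schwartz_norm n N f"
  unfolding schwartz_norm_def
proof (rule cSup_upper)
  show "bdd_above (weighted_derivs n N f)"
    using assms(1) by (simp add: schwartz_space_def)
qed (use assms(2-) in \<open>unfold weighted_derivs_def, blast\<close>)

lemma schwartz_norm_least:
  assumes "\<And>xs \<alpha>. length xs = n \<Longrightarrow> \<alpha> \<in> derivs n \<Longrightarrow> length \<alpha> \<le> N \<Longrightarrow>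
    (1 + list_norm xs) ^ N * cmod (partials \<alpha> f xs) \<le> b"
  shows "schwartz_norm n N f \<le> b"
  unfolding schwartz_norm_def
proof (rule cSup_least[OF weighted_derivs_nonempty])
  fix y assume "y \<in> weighted_derivs n N f"
  then show "y \<le> b"
    unfolding weighted_derivs_def using assms by blast
qed

lemma schwartz_norm_nonneg:
  fixes f :: "('s::finite) fseq"
  assumes "f \<in> schwartz_space n"
  shows "0 \<le> schwartz_norm n N f"
proof -
  obtain y where "y \<in> weighted_derivs n N f"
    using weighted_derivs_nonempty by blast
  moreover have "bdd_above (weighted_derivs n N f)"
    using assms by (simp add: schwartz_space_def)
  ultimately show ?thesis
    unfolding schwartz_norm_def by (meson cSup_upper2 weighted_derivs_nonneg)
qed

lemma schwartz_norm_zero: "schwartz_norm n N 0 = 0"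
proof (rule antisym)
  show "schwartz_norm n N 0 \<le> 0"
    by (rule schwartz_norm_least) (simp add: zero_fun_def partials_zero)
qed (rule schwartz_norm_nonneg[OF zero_schwartz_space])

lemma schwartz_norm_lincomb:
  fixes f g :: "('s::finite) fseq"
  assumes f: "f \<in> schwartz_space n" and g: "g \<in> schwartz_space n"
  shows "schwartz_norm n N (scaleB a f + scaleB b g)
    \<le> cmod a * schwartz_norm n N f + cmod b * schwartz_norm n N g"
proof (rule schwartz_norm_least)
  fix xs :: "'s spacetime list" and \<alpha> :: "(nat \<times> 's option) list"
  assume xs: "length xs = n" and \<alpha>: "\<alpha> \<in> derivs n" "length \<alpha> \<le> N"
  let ?w = "(1 + list_norm xs) ^ N"
  have "smooth n f" "smooth n g"
    using f g by (auto simp: schwartz_space_def)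
  from partials_lincomb[OF this _ \<alpha>(1) xs, of "scaleB a f + scaleB b g" a b]
  have "partials \<alpha> (scaleB a f + scaleB b g) xs = a * partials \<alpha> f xs + b * partials \<alpha> g xs"
    by (simp add: scaleB_def)
  then have "?w * cmod (partials \<alpha> (scaleB a f + scaleB b g) xs)
      \<le> ?w * (cmod a * cmod (partials \<alpha> f xs) + cmod b * cmod (partials \<alpha> g xs))"
    using list_norm_nonneg[of xs]
    by (intro mult_left_mono) (metis norm_mult norm_triangle_ineq, simp)
  also have "\<dots> = cmod a * (?w * cmod (partials \<alpha> f xs)) + cmod b * (?w * cmod (partials \<alpha> g xs))"
    by (simp add: algebra_simps)
  also have "\<dots> \<le> cmod a * schwartz_norm n N f + cmod b * schwartz_norm n N g"
    using f g xs \<alpha> by (intro add_mono mult_left_mono schwartz_norm_upper) auto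
  finally show "?w * cmod (partials \<alpha> (scaleB a f + scaleB b g) xs)
      \<le> cmod a * schwartz_norm n N f + cmod b * schwartz_norm n N g" .
qed

section \<open>An integrable weight and the comparison of Sobolev and Schwartz norms\<close>

text \<open>A product over coordinates stands in for a power of \<open>1 + norm x\<close>, because
  its integral factors into one-dimensional integrals.\<close>

definition decay :: "'a::euclidean_space \<Rightarrow> real" where
  "decay x = (\<Prod>b\<in>Basis. inverse (1 + (x \<bullet> b)\<^sup>2))"

lemma decay_nonneg: "0 \<le> decay x"
  by (simp add: decay_def prod_nonneg)

text \<open>By Tonelli the integral is a finite power of the integral of
  \<open>inverse (1 + t^2)\<close> over the line, which is finite.\<close>

lemma integrable_decay: "integrable lborel (decay :: 'a::euclidean_space \<Rightarrow> real)"
proof -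
  have "integrable lborel (\<lambda>t::real. inverse (1 + t\<^sup>2))"
    using integrable_inverse_1_plus_square by (simp add: set_integrable_def)
  then have fin: "(\<integral>\<^sup>+t. ennreal (inverse (1 + (t::real)\<^sup>2)) \<partial>lborel) < \<infinity>"
    by (simp add: integrable_iff_bounded)
  have "(\<integral>\<^sup>+x. ennreal (decay (x::'a)) \<partial>lborel)
      = (\<integral>\<^sup>+x. (\<Prod>b\<in>Basis. ennreal (inverse (1 + ((x::'a) \<bullet> b)\<^sup>2))) \<partial>lborel)"
    by (simp add: decay_def prod_ennreal)
  also have "\<dots> = (\<Prod>b\<in>(Basis::'a set). \<integral>\<^sup>+t. ennreal (inverse (1 + (t::real)\<^sup>2)) \<partial>lborel)"
    by (rule nn_integral_lborel_prod[where f = "\<lambda>_ t. ennreal (inverse (1 + t\<^sup>2))"]) auto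
  also have "\<dots> < \<infinity>"
    using fin by (simp add: power_less_top_ennreal)
  finally have "(\<integral>\<^sup>+x. ennreal (decay (x::'a)) \<partial>lborel) < \<infinity>" .
  moreover have "decay \<in> borel_measurable (borel :: 'a measure)"
    unfolding decay_def[abs_def] by measurable
  ultimately show ?thesis
    by (simp add: integrable_iff_bounded decay_nonneg)
qed

lemma integrable_prod_decay:
  fixes n :: nat
  shows "integrable (Pi\<^sub>M {..<n} (\<lambda>_. lborel)) (\<lambda>x. \<Prod>i<n. decay (x i :: 'a::euclidean_space))"
proof -
  interpret product_sigma_finite "\<lambda>_::nat. lborel :: 'a measure"
    by standard
  show ?thesis
    by (rule product_integrable_prod[where f = "\<lambda>_. decay"]) (simp_all add: integrable_decay)
qed

text \<open>Each of the \<open>DIM * n\<close> factors \<open>1 + (xs ! i \<bullet> b)^2\<close> is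
  at most \<open>(1 + list_norm xs)^2\<close>, so the product of their inverses is at least the
  inverse of the displayed power. Multiplying by this quantity buys integrability at the price of a
  higher polynomial weight.\<close>

lemma one_le_decay:
  fixes xs :: "('s::finite) spacetime list"
  assumes "length xs = n"
  shows "1 \<le> ((1 + list_norm xs) ^ (DIM('s spacetime) * n))\<^sup>2 * (\<Prod>i<n. decay (xs ! i))"
proof -
  let ?l = "1 + list_norm xs"
  have l: "?l > 0"
    using list_norm_nonneg[of xs] by simp
  have "inverse (?l\<^sup>2) \<le> inverse (1 + (xs ! i \<bullet> b)\<^sup>2)" if "i < n" "b \<in> Basis" for i b
  proof -
    have "\<bar>xs ! i \<bullet> b\<bar> \<le> list_norm xs"
      using Basis_le_norm[OF that(2), of "xs ! i"] norm_nth_le_list_norm[of i xs] that(1) assms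
      by simp
    then have "(xs ! i \<bullet> b)\<^sup>2 \<le> (list_norm xs)\<^sup>2"
      by (rule abs_le_square_iff[THEN iffD1, OF order_trans]) simp
    then have "1 + (xs ! i \<bullet> b)\<^sup>2 \<le> ?l\<^sup>2"
      using list_norm_nonneg[of xs] by (simp add: power2_sum)
    then show ?thesis
      by (intro le_imp_inverse_le) (simp_all add: add_pos_nonneg)
  qed
  then have "(\<Prod>i<n. \<Prod>b\<in>(Basis::'s spacetime set). inverse (?l\<^sup>2)) \<le> (\<Prod>i<n. decay (xs ! i))"
    unfolding decay_def by (intro prod_mono conjI prod_nonneg) auto
  then have "inverse ((?l ^ (DIM('s spacetime) * n))\<^sup>2) \<le> (\<Prod>i<n. decay (xs ! i))"
    by (simp add: power_inverse mult_ac del: DIM_cart flip: power_mult)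
  then have "(?l ^ (DIM('s spacetime) * n))\<^sup>2 * inverse ((?l ^ (DIM('s spacetime) * n))\<^sup>2)
      \<le> (?l ^ (DIM('s spacetime) * n))\<^sup>2 * (\<Prod>i<n. decay (xs ! i))"
    by (rule mult_left_mono) simp
  then show ?thesis
    using l by simp
qed

lemma sobolev_norm_le_schwartz_norm:
  fixes n K L :: nat
  obtains C N where "0 \<le> C"
    and "\<And>f :: ('s::finite) fseq. f \<in> schwartz_space n \<Longrightarrow> sobolev_norm n K L f \<le> C * schwartz_norm n N f"
proof -
  let ?D = "DIM('s spacetime) * n"
  \<comment> \<open>\<open>K\<close> admits all derivatives that occur, \<open>L\<close> absorbs the
    Sobolev weight through \<open>1 + l^2 \<le> (1 + l)^2\<close>, and \<open>?D\<close> pays for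
    the integrable factor \<open>?G\<close>.\<close>
  let ?N = "K + L + ?D"
  let ?\<mu> = "Pi\<^sub>M {..<n} (\<lambda>_. lborel :: 's spacetime measure)"
  let ?G = "\<lambda>x :: nat \<Rightarrow> 's spacetime. \<Prod>i<n. decay (x i)"
  let ?A = "{\<alpha> \<in> derivs n :: (nat \<times> 's option) list set. length \<alpha> \<le> K}"
  have G: "0 \<le> ?G x" for x
    by (simp add: decay_nonneg prod_nonneg)
  have "sobolev_norm n K L f \<le> sqrt (real (card ?A) * integral\<^sup>L ?\<mu> ?G) * schwartz_norm n ?N f"
    if f: "f \<in> schwartz_space n" for f :: "'s fseq"
  proof -
    let ?M = "schwartz_norm n ?N f"
    let ?F = "\<lambda>\<alpha> x. (1 + (list_norm (map x [0..<n]))\<^sup>2) ^ L * (cmod (partials \<alpha> f (map x [0..<n])))\<^sup>2"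
    have M: "0 \<le> ?M"
      using f by (rule schwartz_norm_nonneg)
    have pointwise: "?F \<alpha> x \<le> ?M\<^sup>2 * ?G x" if \<alpha>: "\<alpha> \<in> ?A" for \<alpha> x
    proof -
      define xs where "xs = map x [0..<n]"
      let ?l = "list_norm xs"
      let ?c = "cmod (partials \<alpha> f xs)"
      have l: "0 \<le> ?l" by (rule list_norm_nonneg)
      have xs: "length xs = n" by (simp add: xs_def)
      have G_eq: "(\<Prod>i<n. decay (xs ! i)) = ?G x"
        by (rule prod.cong) (simp_all add: xs_def)
      have "(1 + ?l\<^sup>2) ^ L * ?c\<^sup>2 \<le> ((1 + ?l)\<^sup>2) ^ L * ?c\<^sup>2"
        using l by (intro mult_right_mono power_mono) (simp_all add: power2_sum)
      also have "\<dots> = ((1 + ?l) ^ L * ?c)\<^sup>2"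
        by (simp add: power_mult_distrib power_mult[symmetric] mult.commute)
      also have "\<dots> \<le> ((1 + ?l) ^ (K + L) * ?c)\<^sup>2"
        using l by (intro power_mono mult_right_mono power_increasing) auto
      also have "\<dots> \<le> ((1 + ?l) ^ (K + L) * ?c)\<^sup>2 * (((1 + ?l) ^ ?D)\<^sup>2 * ?G x)"
        using mult_left_mono[OF one_le_decay[OF xs], of "((1 + ?l) ^ (K + L) * ?c)\<^sup>2"]
        by (simp add: G_eq)
      also have "\<dots> = ((1 + ?l) ^ ?N * ?c)\<^sup>2 * ?G x"
        by (simp add: power_add power_mult_distrib)
      also have "\<dots> \<le> ?M\<^sup>2 * ?G x"
        using \<alpha> l by (intro mult_right_mono power_mono schwartz_norm_upper f xs G) auto
      finally show ?thesis
        by (simp add: xs_def)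
    qed
    \<comment> \<open>Only the dominating function has to be integrable: a non-integrable
      \<open>?F \<alpha>\<close> would have integral 0, and the bound is nonnegative.\<close>
    have "integral\<^sup>L ?\<mu> (?F \<alpha>) \<le> integral\<^sup>L ?\<mu> (\<lambda>x. ?M\<^sup>2 * ?G x)" if "\<alpha> \<in> ?A" for \<alpha>
      by (rule integral_mono') (use pointwise[OF that] G in \<open>auto intro: integrable_prod_decay\<close>)
    then have "(\<Sum>\<alpha>\<in>?A. integral\<^sup>L ?\<mu> (?F \<alpha>)) \<le> real (card ?A) * (?M\<^sup>2 * integral\<^sup>L ?\<mu> ?G)"
      by (intro sum_bounded_above) simp
    also have "\<dots> = real (card ?A) * integral\<^sup>L ?\<mu> ?G * ?M\<^sup>2"
      by simp
    finally have "sobolev_norm n K L f \<le> sqrt (real (card ?A) * integral\<^sup>L ?\<mu> ?G * ?M\<^sup>2)"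
      unfolding sobolev_norm_def by (rule real_sqrt_le_mono)
    also have "\<dots> = sqrt (real (card ?A) * integral\<^sup>L ?\<mu> ?G) * ?M"
      using M by (simp add: real_sqrt_mult)
    finally show ?thesis .
  qed
  moreover have "0 \<le> sqrt (real (card ?A) * integral\<^sup>L ?\<mu> ?G)"
    using G by (intro real_sqrt_ge_zero mult_nonneg_nonneg integral_nonneg) auto
  ultimately show ?thesis
    using that by blast
qed

section \<open>Null sequences in the Borchers algebra\<close>

lemma borchers_space_diff:
  assumes "f \<in> borchers_space" "g \<in> borchers_space"
  shows "f - g \<in> borchers_space"
proof -
  have "scaleB 1 f + scaleB (-1) g = f - g"
    by (auto simp: scaleB_def)
  then show ?thesis
    using borchers_space_lincomb[OF assms, of 1 "-1"] by simp
qed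

lemma zero_borchers_space: "0 \<in> borchers_space"
  using zero_schwartz_space schwartz_subset_borchers by blast

lemma absolutely_convex_halves:
  assumes "absolutely_convex C" "g \<in> C" "h \<in> C"
  shows "scaleB (1/2) g + scaleB (1/2) h \<in> C"
proof -
  have "cmod a + cmod b \<le> 1 \<Longrightarrow> scaleB a g + scaleB b h \<in> C" for a b
    using assms unfolding absolutely_convex_def by blast
  from this[of "1/2" "1/2"] show ?thesis by (simp add: norm_divide)
qed

lemma scaleB_lincomb:
  "scaleB c (scaleB a f + scaleB b g) = scaleB a (scaleB c f) + scaleB b (scaleB c g)"
  by (rule ext) (simp add: scaleB_def algebra_simps)

text \<open>Specialises facts about two-term linear combinations to scalar multiples.\<close>

lemma scaleB_add_zero: "scaleB c f + scaleB 0 0 = scaleB c f"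
  by (rule ext) (simp add: scaleB_def)

lemma schwartz_norm_scaleB_le:
  assumes "f \<in> schwartz_space n"
  shows "schwartz_norm n N (scaleB c f) \<le> cmod c * schwartz_norm n N f"
  using schwartz_norm_lincomb[OF assms zero_schwartz_space, of N c 0]
  by (simp add: scaleB_add_zero)

lemma scaleB_schwartz_space: "f \<in> schwartz_space n \<Longrightarrow> scaleB c f \<in> schwartz_space n"
  using schwartz_space_lincomb[OF _ zero_schwartz_space, of f n c 0]
  by (simp add: scaleB_add_zero)

text \<open>This is \<open>C\<close> shrunk by one half, with balls of half the radius inside. By
  convexity the sum of two of its elements lies in \<open>C\<close>, which is how it serves in the
  proof that interiors are open.\<close>

lemma basic_zero_nhd_double:
  fixes C :: "('s::finite) fseq set"
  assumes C: "basic_zero_nhd C"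
  shows "basic_zero_nhd {g \<in> borchers_space. scaleB 2 g \<in> C}" (is "basic_zero_nhd ?D")
  unfolding basic_zero_nhd_def
proof (intro conjI allI)
  show "?D \<subseteq> borchers_space" by blast
  show "absolutely_convex ?D"
    using C unfolding basic_zero_nhd_def absolutely_convex_def
    by (auto simp: scaleB_lincomb intro: borchers_space_lincomb)
  fix n
  obtain N \<epsilon> where \<epsilon>: "\<epsilon> > 0" "{f \<in> schwartz_space n. schwartz_norm n N f < \<epsilon>} \<subseteq> C"
    using C unfolding basic_zero_nhd_def by blast
  have "f \<in> ?D" if f: "f \<in> schwartz_space n" and "schwartz_norm n N f < \<epsilon> / 2" for f
  proof -
    have "schwartz_norm n N (scaleB 2 f) < \<epsilon>"
      using schwartz_norm_scaleB_le[OF f, of N 2] that(2) by simp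
    then show ?thesis
      using \<epsilon>(2) f scaleB_schwartz_space[OF f] schwartz_subset_borchers by blast
  qed
  then show "\<exists>N. \<exists>\<epsilon>>0. {f \<in> schwartz_space n. schwartz_norm n N f < \<epsilon>} \<subseteq> ?D"
    using \<epsilon>(1) by (intro exI[of _ N] exI[of _ "\<epsilon> / 2"]) auto
qed

lemma zero_in_basic_zero_nhd: "basic_zero_nhd C \<Longrightarrow> 0 \<in> C"
  unfolding basic_zero_nhd_def using zero_schwartz_space by (force simp: schwartz_norm_zero)

text \<open>Topological convergence speaks of open sets, while \<open>f + C\<close> itself need not
  be open. The argument therefore uses the points around which some translated basic neighbourhood
  stays inside \<open>f + C\<close>.\<close>

lemma limitin_borchers_eventually:
  fixes f :: "('s::finite) fseq"
  assumes lim: "limitin borchers_topology fs f F" and C: "basic_zero_nhd C"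
  shows "\<forall>\<^sub>F n in F. fs n - f \<in> C"
proof -
  \<comment> \<open>the interior of \<open>f + C\<close>\<close>
  define U where "U = {h \<in> borchers_space. \<exists>D. basic_zero_nhd D \<and> (\<forall>g\<in>D. h + g - f \<in> C)}"
  have f: "f \<in> borchers_space"
    using lim by (auto simp: limitin_def topspace_borchers_topology)
  have "openB U"
    unfolding openB_def
  proof (intro conjI ballI)
    show "U \<subseteq> borchers_space" by (auto simp: U_def)
    fix h assume "h \<in> U"
    then obtain D where h: "h \<in> borchers_space" and D: "basic_zero_nhd D" "\<And>g. g \<in> D \<Longrightarrow> h + g - f \<in> C"
      by (auto simp: U_def)
    \<comment> \<open>Since \<open>?D + ?D \<subseteq> D\<close>, the set \<open>?D\<close>
      witnesses membership in \<open>U\<close> for every point of \<open>h + ?D\<close>.\<close>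
    let ?D = "{g \<in> borchers_space. scaleB 2 g \<in> D}"
    have half: "basic_zero_nhd ?D"
      using D(1) by (rule basic_zero_nhd_double)
    have "h + g \<in> U" if g: "g \<in> ?D" for g
    proof -
      have "h + g + k - f \<in> C" if k: "k \<in> ?D" for k
      proof -
        have "scaleB (1/2) (scaleB 2 g) + scaleB (1/2) (scaleB 2 k) \<in> D"
          using D(1) g k by (intro absolutely_convex_halves) (auto simp: basic_zero_nhd_def)
        then have "g + k \<in> D"
          by (simp add: scaleB_def plus_fun_def)
        then show ?thesis
          using D(2)[of "g + k"] by (simp add: add.assoc)
      qed
      moreover have "h + g \<in> borchers_space"
        using borchers_space_lincomb[OF h, of g 1 1] g by (simp add: scaleB_def)
      ultimately show ?thesis
        using half by (auto simp: U_def)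
    qed
    then show "\<exists>D. basic_zero_nhd D \<and> (\<forall>g\<in>D. h + g \<in> U)"
      using half by blast
  qed
  moreover have "f \<in> U"
    using f C by (auto simp: U_def intro!: exI[of _ C])
  ultimately have "\<forall>\<^sub>F n in F. fs n \<in> U"
    using lim by (simp add: limitin_def openin_borchers_topology)
  then show ?thesis
  proof eventually_elim
    case (elim n)
    then obtain D where "basic_zero_nhd D" "\<forall>g\<in>D. fs n + g - f \<in> C"
      \<comment> \<open>Taking \<open>g = 0\<close> in \<open>D\<close> turns membership in
        \<open>U\<close> into membership of \<open>fs n - f\<close> in \<open>C\<close>.\<close>
      by (auto simp: U_def)
    then show ?case
      using zero_in_basic_zero_nhd[of D] by fastforce
  qed
qed

section \<open>Continuity of the seminorms at \<open>0\<close>\<close>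

text \<open>The preimage of an interval around \<open>0\<close> is open and contains
  \<open>0\<close>, because \<open>p 0 = 0\<close>; hence it contains a basic neighbourhood, in
  which \<open>fs n - f\<close> eventually lies.\<close>

lemma tendsto_sobolev_dominated:
  fixes f :: "('s::finite) fseq"
  assumes p: "sobolev_dominated p" "hilbert_seminorm p"
    and lim: "limitin borchers_topology fs f F"
  shows "((\<lambda>n. p (fs n - f)) \<longlongrightarrow> 0) F"
proof (rule tendstoI)
  fix e :: real assume e: "e > 0"
  obtain B where B: "sesquilinear_on borchers_space scaleB B"
    "\<And>f. f \<in> borchers_space \<Longrightarrow> p f = sqrt (Re (B f f))"
    using p(2) unfolding hilbert_seminorm_def by blast
  have "B (0 + 0) 0 = B 0 0 + B 0 0"
    using B(1) zero_borchers_space unfolding sesquilinear_on_def by blast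
  then have p0: "p 0 = 0"
    using B(2)[OF zero_borchers_space] by simp
  have "openin borchers_topology {f \<in> topspace borchers_topology. p f \<in> {-e<..<e}}"
    using p(1) unfolding sobolev_dominated_def
    by (rule openin_continuous_map_preimage) (simp add: open_openin[symmetric])
  then have "openB {f \<in> borchers_space. p f \<in> {-e<..<e}}"
    by (simp add: openin_borchers_topology topspace_borchers_topology)
  moreover have "0 \<in> {f \<in> borchers_space. p f \<in> {-e<..<e}}"
    using e p0 zero_borchers_space by simp
  ultimately obtain C where C: "basic_zero_nhd C" "\<And>g. g \<in> C \<Longrightarrow> 0 + g \<in> {f \<in> borchers_space. p f \<in> {-e<..<e}}"
    unfolding openB_def by meson
  show "\<forall>\<^sub>F n in F. dist (p (fs n - f)) 0 < e"
    using limitin_borchers_eventually[OF lim C(1)]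
    by eventually_elim (use C(2) in \<open>fastforce simp: dist_real_def\<close>)
qed

text \<open>A ball of the weighted sum of Schwartz norms. The ball condition is tested on each
  \<open>schwartz_space n\<close> separately, where a single summand survives, so \<open>c\<close>
  and \<open>N\<close> may depend on \<open>n\<close> without any uniformity. Bounding all finite
  partial sums fixes the index sets independently of the support of \<open>f\<close>, so that
  convexity follows termwise.\<close>

lemma basic_zero_nhd_schwartz_sum:
  fixes c :: "nat \<Rightarrow> real" and N :: "nat \<Rightarrow> nat"
  assumes c: "\<And>n. 0 \<le> c n" and e: "e > 0"
  shows "basic_zero_nhd {f \<in> borchers_space :: ('s::finite) fseq set.
    \<forall>A. finite A \<longrightarrow> (\<Sum>n\<in>A. c n * schwartz_norm n (N n) (component n f)) \<le> e}"
    (is "basic_zero_nhd {f \<in> _. \<forall>A. _ \<longrightarrow> ?S A f \<le> e}" is "basic_zero_nhd ?C")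
  unfolding basic_zero_nhd_def
proof (intro conjI allI)
  show "?C \<subseteq> borchers_space" by blast
  show "absolutely_convex ?C"
    unfolding absolutely_convex_def
  proof (intro ballI allI impI)
    fix f g a b assume f: "f \<in> ?C" and g: "g \<in> ?C" and ab: "cmod a + cmod b \<le> 1"
    have "?S A (scaleB a f + scaleB b g) \<le> e" if A: "finite A" for A
    proof -
      have "?S A (scaleB a f + scaleB b g) \<le> (\<Sum>n\<in>A. c n * (cmod a * schwartz_norm n (N n) (component n f)
          + cmod b * schwartz_norm n (N n) (component n g)))"
        unfolding component_lincomb using f g
        by (intro sum_mono mult_left_mono c schwartz_norm_lincomb) (auto simp: borchers_space_def)
      also have "\<dots> = cmod a * ?S A f + cmod b * ?S A g"
        by (simp add: sum_distrib_left sum.distrib algebra_simps)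
      also have "\<dots> \<le> cmod a * e + cmod b * e"
        using f g A by (intro add_mono mult_left_mono) auto
      also have "\<dots> \<le> e"
        using mult_right_mono[OF ab, of e] e by (simp add: algebra_simps)
      finally show ?thesis .
    qed
    then show "scaleB a f + scaleB b g \<in> ?C"
      using f g by (auto intro: borchers_space_lincomb)
  qed
  fix n
  \<comment> \<open>The \<open>+ 1\<close> keeps the radius meaningful when
    \<open>c n = 0\<close>.\<close>
  have "f \<in> ?C" if f: "f \<in> schwartz_space n" and small: "schwartz_norm n (N n) f < e / (c n + 1)"
    for f :: "'s fseq"
  proof -
    have "component m f = (if m = n then f else 0)" for m
      using f by (auto simp: component_def schwartz_space_def fun_eq_iff)
    then have "c m * schwartz_norm m (N m) (component m f)
        = (if m = n then c n * schwartz_norm n (N n) f else 0)" for m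
      by (simp add: schwartz_norm_zero)
    moreover have "c n * schwartz_norm n (N n) f \<le> e"
    proof -
      have "c n * schwartz_norm n (N n) f \<le> (c n + 1) * schwartz_norm n (N n) f"
        by (intro mult_right_mono schwartz_norm_nonneg f) simp
      also have "\<dots> \<le> e"
        using small c[of n] by (simp add: field_simps)
      finally show ?thesis .
    qed
    ultimately show ?thesis
      using f e schwartz_subset_borchers by auto
  qed
  then show "\<exists>M. \<exists>\<epsilon>>0. {f \<in> schwartz_space n. schwartz_norm n M f < \<epsilon>} \<subseteq> ?C"
    using e c[of n] by (intro exI[of _ "N n"] exI[of _ "e / (c n + 1)"]) auto
qed

text \<open>The Euclidean combination of the Sobolev norms is at most their sum, hence at most a
  weighted sum of Schwartz norms, which is small on a basic neighbourhood.\<close>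

lemma tendsto_sobolev_direct_sum_norm:
  fixes f :: "('s::finite) fseq"
  assumes p\<^sub>1: "sobolev_direct_sum_norm p\<^sub>1"
    and lim: "limitin borchers_topology fs f F"
  shows "((\<lambda>n. p\<^sub>1 (fs n - f)) \<longlongrightarrow> 0) F"
proof -
  obtain K L :: "nat \<Rightarrow> nat" where p\<^sub>1_eq: "\<And>f. f \<in> borchers_space \<Longrightarrow>
      p\<^sub>1 f = L2_set (\<lambda>n. sobolev_norm n (K n) (L n) (component n f)) {n. component n f \<noteq> 0}"
    using p\<^sub>1 unfolding sobolev_direct_sum_norm_def L2_set_def by blast
  have "\<exists>c N. 0 \<le> c \<and> (\<forall>f :: 's fseq. f \<in> schwartz_space n \<longrightarrow>
      sobolev_norm n (K n) (L n) f \<le> c * schwartz_norm n N f)" for n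
    by (metis sobolev_norm_le_schwartz_norm)
  then obtain c N where c: "\<And>n. 0 \<le> c n" and le: "\<And>n f :: 's fseq. f \<in> schwartz_space n \<Longrightarrow>
      sobolev_norm n (K n) (L n) f \<le> c n * schwartz_norm n (N n) f"
    by metis
  show ?thesis
  proof (rule tendstoI)
    fix e :: real assume e: "e > 0"
    \<comment> \<open>The radius \<open>e / 2\<close> makes up for the non-strict
      inequality.\<close>
    let ?C = "{f \<in> borchers_space :: 's fseq set.
      \<forall>A. finite A \<longrightarrow> (\<Sum>n\<in>A. c n * schwartz_norm n (N n) (component n f)) \<le> e / 2}"
    have "basic_zero_nhd ?C"
      using c e by (intro basic_zero_nhd_schwartz_sum) auto
    with lim have "\<forall>\<^sub>F n in F. fs n - f \<in> ?C"
      by (rule limitin_borchers_eventually)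
    then show "\<forall>\<^sub>F n in F. dist (p\<^sub>1 (fs n - f)) 0 < e"
    proof eventually_elim
      case (elim n)
      let ?g = "fs n - f"
      let ?A = "{n. component n ?g \<noteq> 0}"
      \<comment> \<open>The neighbourhood controls finite sums only, so the degrees occurring in
        \<open>?g\<close> must be finite in number.\<close>
      obtain m where "\<forall>n>m. component n ?g = 0"
        using elim unfolding borchers_space_def by blast
      then have "?A \<subseteq> {..m}"
        by (auto simp: not_less[symmetric])
      then have "finite ?A"
        using finite_subset by blast
      have "p\<^sub>1 ?g \<le> (\<Sum>n\<in>?A. sobolev_norm n (K n) (L n) (component n ?g))"
        using elim by (auto simp: p\<^sub>1_eq sobolev_norm_def
          intro!: L2_set_le_sum sum_nonneg integral_nonneg)
      also have "\<dots> \<le> (\<Sum>n\<in>?A. c n * schwartz_norm n (N n) (component n ?g))"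
        using elim by (intro sum_mono le) (auto simp: borchers_space_def)
      also have "\<dots> \<le> e / 2"
        using elim \<open>finite ?A\<close> by blast
      finally show ?case
        using elim e by (simp add: p\<^sub>1_eq L2_set_nonneg dist_real_def)
    qed
  qed
qed

lemma tendsto_adjusted_norm:
  assumes "((\<lambda>n. p (g n)) \<longlongrightarrow> 0) F" "((\<lambda>n. p\<^sub>1 (g n)) \<longlongrightarrow> 0) F"
  shows "((\<lambda>n. adjusted_norm p p\<^sub>1 (g n)) \<longlongrightarrow> 0) F"
proof -
  have "((\<lambda>n. sqrt ((p (g n))\<^sup>2 + (p\<^sub>1 (g n))\<^sup>2)) \<longlongrightarrow> sqrt (0\<^sup>2 + 0\<^sup>2)) F"
    by (intro tendsto_intros assms)
  then show ?thesis
    using assms(1) by (auto simp: adjusted_norm_def)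
qed

section \<open>The vectors \<open>\<phi>(f)\<Omega>\<close>\<close>

lemma unitB_borchers_space: "(unitB :: ('s::finite) fseq) \<in> borchers_space"
proof -
  have "derivs 0 = {[] :: (nat \<times> 's option) list}"
    by (auto simp: derivs_def lists_empty)
  then have "weighted_derivs 0 N (unitB :: 's fseq) \<subseteq> {1}" for N
    by (auto simp: weighted_derivs_def unitB_def list_norm_def)
  then have "bdd_above (weighted_derivs 0 N (unitB :: 's fseq))" for N
    by (meson bdd_above_mono bdd_above_finite finite.intros)
  then have "(unitB :: 's fseq) \<in> schwartz_space 0"
    using \<open>derivs 0 = _\<close> by (auto simp: schwartz_space_def smooth_def unitB_def)
  then show ?thesis
    using schwartz_subset_borchers by blast
qed

text \<open>Of all splittings of \<open>xs\<close>, only the one with empty second part meets the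
  support of \<open>unitB\<close>.\<close>

lemma tensor_unitB: "f \<otimes>\<^sub>B unitB = f"
proof
  fix xs
  have "(f \<otimes>\<^sub>B unitB) xs = (\<Sum>j\<le>length xs. if j = length xs then f xs else 0)"
    unfolding tensor_def by (rule sum.cong) (auto simp: unitB_def)
  then show "(f \<otimes>\<^sub>B unitB) xs = f xs" by simp
qed

section \<open>Linear maps on carriers and Hilbert norms\<close>

lemma linear_between_diff:
  assumes T: "linear_between V s W t T" and "u \<in> V" "v \<in> V" "u - v \<in> V"
  shows "T (u - v) = T u - T v"
proof -
  have "T (u - v + v) = T (u - v) + T v"
    using assms unfolding linear_between_def by blast
  then show ?thesis by simp
qed

lemma linear_between_mem: "linear_between V s W t T \<Longrightarrow> v \<in> V \<Longrightarrow> T v \<in> W"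
  by (auto simp: linear_between_def)

lemma hilbert_space_psd: "hilbert_space H \<Longrightarrow> psd_on (carr H) (ip H)"
  unfolding hilbert_space_def by blast

lemma hnorm_nonneg: "hilbert_space H \<Longrightarrow> v \<in> carr H \<Longrightarrow> 0 \<le> hnorm H v"
  using hilbert_space_psd[of H] by (simp add: psd_on_def hnorm_def)

lemma hnorm_sq: "hilbert_space H \<Longrightarrow> v \<in> carr H \<Longrightarrow> (hnorm H v)\<^sup>2 = Re (ip H v v)"
  using hilbert_space_psd[of H] by (simp add: psd_on_def hnorm_def)

text \<open>Expand the nonnegative square of the norm of \<open>u - v\<close>. Together with a
  contraction bound this does the work of the Cauchy-Schwarz inequality.\<close>

lemma two_Re_ip_le:
  assumes H: "hilbert_space H" and uv: "u \<in> carr H" "v \<in> carr H"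
  shows "2 * Re (ip H u v) \<le> (hnorm H u)\<^sup>2 + (hnorm H v)\<^sup>2"
proof -
  interpret vector_space "smul H" using H unfolding hilbert_space_def by blast
  \<comment> \<open>\<open>-v\<close> is written as a scalar multiple so that sesquilinearity
    applies to it directly.\<close>
  define w where "w = smul H (-1) v"
  have sub: "subspace (carr H)" and sesq: "sesquilinear_on (carr H) (smul H) (ip H)"
    and herm: "ip H v u = cnj (ip H u v)" and psd: "psd_on (carr H) (ip H)"
    using H uv unfolding hilbert_space_def by blast+
  have w: "w \<in> carr H" and uw: "u + w \<in> carr H"
    using sub uv unfolding w_def by (blast intro: subspace_scale subspace_add)+
  have scale: "ip H (smul H c x) y = cnj c * ip H x y" "ip H x (smul H c y) = c * ip H x y"
    if "x \<in> carr H" "y \<in> carr H" for c x y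
    using sesq that unfolding sesquilinear_on_def by blast+
  have "ip H u w = - ip H u v" "ip H w u = - ip H v u" "ip H w w = ip H v v"
    using scale(2)[OF uv, of "-1"] scale(1)[OF uv(2,1), of "-1"]
      scale(1)[OF uv(2) w, of "-1"] scale(2)[OF uv(2) uv(2), of "-1"]
    unfolding w_def[symmetric] by simp_all
  moreover have "ip H (u + w) (u + w) = ip H u u + ip H u w + (ip H w u + ip H w w)"
    using sesq uv w uw unfolding sesquilinear_on_def by simp
  moreover have "0 \<le> Re (ip H (u + w) (u + w))"
    using psd uw by (simp add: psd_on_def)
  ultimately show ?thesis
    using herm by (simp add: hnorm_sq[OF H] uv)
qed

section \<open>Contraction estimates from \<open>H\<^sub>1\<close> through \<open>H\<^sub>2\<close>
  to \<open>H\<close>\<close>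

context krein_space_construction
begin

text \<open>Self-adjointness of both operators and equality of their squares give
  \<open>abs_\<eta>\<^sub>2 u\<close> and \<open>\<eta>\<^sub>2 u\<close> the same norm.\<close>

lemma hnorm_abs_\<eta>\<^sub>2_le:
  assumes u: "u \<in> carr H\<^sub>2"
  shows "hnorm H\<^sub>2 (abs_\<eta>\<^sub>2 u) \<le> hnorm H\<^sub>2 u"
proof -
  have sa: "self_adjoint H\<^sub>2 abs_\<eta>\<^sub>2" and sq: "abs_\<eta>\<^sub>2 (abs_\<eta>\<^sub>2 u) = \<eta>\<^sub>2 (\<eta>\<^sub>2 u)"
    using abs_\<eta>\<^sub>2 u by (auto simp: is_operator_abs_def positive_operator_def)
  have mem: "abs_\<eta>\<^sub>2 u \<in> carr H\<^sub>2" "\<eta>\<^sub>2 u \<in> carr H\<^sub>2"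
    using sa \<eta>\<^sub>2_self_adjoint u by (auto simp: self_adjoint_def bounded_operator_def linear_between_def)
  have "ip H\<^sub>2 (abs_\<eta>\<^sub>2 u) (abs_\<eta>\<^sub>2 u) = ip H\<^sub>2 u (abs_\<eta>\<^sub>2 (abs_\<eta>\<^sub>2 u))"
    using sa u mem by (simp add: self_adjoint_def)
  also have "\<dots> = ip H\<^sub>2 (\<eta>\<^sub>2 u) (\<eta>\<^sub>2 u)"
    using \<eta>\<^sub>2_self_adjoint u mem by (simp add: sq self_adjoint_def)
  finally have "hnorm H\<^sub>2 (abs_\<eta>\<^sub>2 u) = hnorm H\<^sub>2 (\<eta>\<^sub>2 u)"
    by (simp add: hnorm_def)
  then show ?thesis
    using \<eta>\<^sub>2_contraction[OF u] by simp
qed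

text \<open>The squared norm of \<open>j u\<close> is
  \<open>ip H\<^sub>2 u (abs_\<eta>\<^sub>2 u)\<close>, and twice its real part is at most the sum
  of the squared norms of \<open>u\<close> and \<open>abs_\<eta>\<^sub>2 u\<close>.\<close>

lemma hnorm_j_le:
  assumes u: "u \<in> carr H\<^sub>2"
  shows "hnorm H (j u) \<le> hnorm H\<^sub>2 u"
proof (rule power2_le_imp_le)
  have mem: "abs_\<eta>\<^sub>2 u \<in> carr H\<^sub>2"
    using abs_\<eta>\<^sub>2 u by (auto simp: is_operator_abs_def positive_operator_def self_adjoint_def
      bounded_operator_def linear_between_def)
  have "2 * (hnorm H (j u))\<^sup>2 = 2 * Re (ip H\<^sub>2 u (abs_\<eta>\<^sub>2 u))"
    using u linear_between_mem[OF j_linear] by (simp add: hnorm_sq[OF H] j_isometric)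
  also have "\<dots> \<le> (hnorm H\<^sub>2 u)\<^sup>2 + (hnorm H\<^sub>2 (abs_\<eta>\<^sub>2 u))\<^sup>2"
    using H\<^sub>2 u mem by (rule two_Re_ip_le)
  also have "\<dots> \<le> (hnorm H\<^sub>2 u)\<^sup>2 + (hnorm H\<^sub>2 u)\<^sup>2"
    by (intro add_left_mono power_mono hnorm_abs_\<eta>\<^sub>2_le u hnorm_nonneg[OF H\<^sub>2] mem)
  finally show "(hnorm H (j u))\<^sup>2 \<le> (hnorm H\<^sub>2 u)\<^sup>2" by simp
qed (rule hnorm_nonneg[OF H\<^sub>2 u])

text \<open>The quotient norm is an infimum over the kernel, and \<open>k = 0\<close> is one
  competitor.\<close>

lemma hnorm_q_le:
  assumes v: "v \<in> carr H\<^sub>1"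
  shows "hnorm H\<^sub>2 (q v) \<le> hnorm H\<^sub>1 v"
proof -
  let ?N = "{v \<in> carr H\<^sub>1. \<forall>w\<in>carr H\<^sub>1. form w v = 0}"
  interpret vector_space "smul H\<^sub>1" using H\<^sub>1 unfolding hilbert_space_def by blast
  have sub: "subspace (carr H\<^sub>1)"
    using H\<^sub>1 by (simp add: hilbert_space_def)
  have 0: "0 \<in> carr H\<^sub>1"
    using sub by (rule subspace_0)
  have "form w (0 + 0) = form w 0 + form w 0" if "w \<in> carr H\<^sub>1" for w
    using form_sesquilinear 0 that unfolding sesquilinear_on_def by blast
  then have "0 \<in> ?N"
    using 0 by simp
  moreover have "bdd_below ((\<lambda>k. hnorm H\<^sub>1 (v - k)) ` ?N)"
    using v by (intro bdd_belowI2[of _ 0] hnorm_nonneg[OF H\<^sub>1] subspace_diff[OF sub]) auto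
  ultimately have "(INF k\<in>?N. hnorm H\<^sub>1 (v - k)) \<le> hnorm H\<^sub>1 (v - 0)"
    by (intro cINF_lower)
  moreover have "hnorm H\<^sub>2 (q v) = (INF k\<in>?N. hnorm H\<^sub>1 (v - k))"
    using q v unfolding is_quotient_map_def by blast
  ultimately show ?thesis by simp
qed

lemma state_mem:
  assumes "f \<in> borchers_space"
  shows "\<iota> f \<in> carr H\<^sub>1" "q (\<iota> f) \<in> carr H\<^sub>2" "state \<iota> q j f \<in> carr H"
proof -
  have q_linear: "linear_between (carr H\<^sub>1) (smul H\<^sub>1) (carr H\<^sub>2) (smul H\<^sub>2) q"
    using q by (simp add: is_quotient_map_def)
  show 1: "\<iota> f \<in> carr H\<^sub>1"
    by (rule linear_between_mem[OF \<iota>_linear assms])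
  show 2: "q (\<iota> f) \<in> carr H\<^sub>2"
    by (rule linear_between_mem[OF q_linear 1])
  show "state \<iota> q j f \<in> carr H"
    unfolding state_def by (rule linear_between_mem[OF j_linear 2])
qed

lemma hnorm_state_le:
  assumes "f \<in> borchers_space"
  shows "hnorm H (state \<iota> q j f) \<le> adjusted_norm p p\<^sub>1 f"
  using hnorm_j_le[OF state_mem(2)[OF assms]] hnorm_q_le[OF state_mem(1)[OF assms]] \<iota>_norm[OF assms]
  by (simp add: state_def)

lemma state_diff:
  assumes f: "f \<in> borchers_space" and g: "g \<in> borchers_space"
  shows "state \<iota> q j (f - g) = state \<iota> q j f - state \<iota> q j g"
proof -
  have q_linear: "linear_between (carr H\<^sub>1) (smul H\<^sub>1) (carr H\<^sub>2) (smul H\<^sub>2) q"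
    using q by (simp add: is_quotient_map_def)
  note fg = borchers_space_diff[OF f g]
  have 1: "\<iota> (f - g) = \<iota> f - \<iota> g"
    by (rule linear_between_diff[OF \<iota>_linear f g fg])
  \<comment> \<open>The difference lies in the carrier because it is \<open>\<iota> (f - g)\<close>;
    the next step argues likewise for \<open>q\<close>.\<close>
  have 2: "q (\<iota> f - \<iota> g) = q (\<iota> f) - q (\<iota> g)"
    using state_mem(1)[OF fg] by (intro linear_between_diff[OF q_linear] state_mem(1) f g) (simp add: 1)
  have "j (q (\<iota> f) - q (\<iota> g)) = j (q (\<iota> f)) - j (q (\<iota> g))"
    using state_mem(2)[OF fg] by (intro linear_between_diff[OF j_linear] state_mem(2) f g) (simp add: 1 2)
  then show ?thesis
    by (simp add: state_def 1 2)
qed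

end

section \<open>The vacuum and the choice of the Krein norm\<close>

context krein_space_representation
begin

lemma \<phi>_vacuum:
  assumes "f \<in> borchers_space"
  shows "\<phi> f \<Omega> = state \<iota> q j f"
  using \<phi>[OF assms unitB_borchers_space] by (simp add: \<Omega> tensor_unitB)

lemma hilbert_space_K: "hilbert_space K"
  using krein_space H by (auto simp: vacuum_adapted_def)

lemma carr_K: "carr K = carr H"
  using krein_space by (auto simp: vacuum_adapted_def)

lemma hnorm_K_le:
  obtains C where "\<And>v. v \<in> carr H \<Longrightarrow> hnorm K v \<le> C * hnorm H v"
proof (cases "K = H")
  case True
  show ?thesis
    by (rule that[of 1]) (simp add: True)
next
  case False
  then show ?thesis
    using krein_space that unfolding vacuum_adapted_def by blast
qed

end

section \<open>Convergence of the vectors by squeezing\<close>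

theorem lemma3p1:
  fixes W :: "('s::finite) fseq \<Rightarrow> complex"
    and p p\<^sub>1 :: "'s fseq \<Rightarrow> real"
    and H\<^sub>1 :: "'a::ab_group_add hspace" and \<iota> :: "'s fseq \<Rightarrow> 'a"
    and form :: "'a \<Rightarrow> 'a \<Rightarrow> complex"
    and H\<^sub>2 :: "'b::ab_group_add hspace" and q :: "'a \<Rightarrow> 'b"
    and \<eta>\<^sub>2 abs_\<eta>\<^sub>2 sign_\<eta>\<^sub>2 :: "'b \<Rightarrow> 'b"
    and H K :: "'h::ab_group_add hspace" and j :: "'b \<Rightarrow> 'h"
    and \<eta> \<theta> :: "'h \<Rightarrow> 'h" and \<Omega> :: 'h and \<phi> :: "'s fseq \<Rightarrow> 'h \<Rightarrow> 'h"
    and fs :: "nat \<Rightarrow> 's fseq" and f :: "'s fseq"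
  assumes A1: "in_dual W" "W unitB = 1"
    and A2: "poincare_invariant W"
    and A3: "spectral_condition W"
    and A4: "local_functional W"
    and A5: "hilbert_structure_condition W p"
    and A6: "cluster_property W"
    and A7: "hermitian_functional W"
    and dominated: "sobolev_dominated p"
    and representation: "krein_space_representation W p p\<^sub>1 H\<^sub>1 \<iota> form H\<^sub>2 q \<eta>\<^sub>2 abs_\<eta>\<^sub>2 sign_\<eta>\<^sub>2
      H j \<eta> K \<theta> \<Omega> \<phi>"
    and fs: "\<And>n. fs n \<in> borchers_space" "f \<in> borchers_space"
    and convergence: "limitin borchers_topology fs f sequentially"
  shows "(\<lambda>n. hnorm K (\<phi> (fs n) \<Omega> - \<phi> f \<Omega>)) \<longlonglongrightarrow> 0"
proof -
  interpret krein_space_representation W p p\<^sub>1 H\<^sub>1 \<iota> form H\<^sub>2 q \<eta>\<^sub>2 abs_\<eta>\<^sub>2 sign_\<eta>\<^sub>2 H j \<eta> K \<theta> \<Omega> \<phi>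
    by (rule representation)
  have diff: "fs n - f \<in> borchers_space" for n
    by (intro borchers_space_diff fs)
  have eq: "\<phi> (fs n) \<Omega> - \<phi> f \<Omega> = state \<iota> q j (fs n - f)" for n
    using fs by (simp add: \<phi>_vacuum state_diff)
  have p: "hilbert_seminorm p"
    using A5 by (simp add: hilbert_structure_condition_def)
  have "(\<lambda>n. adjusted_norm p p\<^sub>1 (fs n - f)) \<longlonglongrightarrow> 0"
    by (intro tendsto_adjusted_norm tendsto_sobolev_dominated[OF dominated p convergence]
      tendsto_sobolev_direct_sum_norm[OF p\<^sub>1 convergence])
  \<comment> \<open>The norm in \<open>H\<close> is squeezed between \<open>0\<close> and the
    adjusted norm; the factor \<open>C\<close> then carries the limit over to
    \<open>K\<close>.\<close>
  from tendsto_sandwich[OF always_eventually always_eventually tendsto_const this]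
  have lim_H: "(\<lambda>n. hnorm H (state \<iota> q j (fs n - f))) \<longlonglongrightarrow> 0"
    by (simp_all add: hnorm_state_le hnorm_nonneg[OF H] state_mem diff)
  obtain C where C: "\<And>v. v \<in> carr H \<Longrightarrow> hnorm K v \<le> C * hnorm H v"
    using hnorm_K_le by blast
  have "(\<lambda>n. C * hnorm H (state \<iota> q j (fs n - f))) \<longlonglongrightarrow> 0"
    using tendsto_mult_right_zero[OF lim_H] .
  from tendsto_sandwich[OF always_eventually always_eventually tendsto_const this]
  show ?thesis
    unfolding eq by (simp_all add: C hnorm_nonneg[OF hilbert_space_K] carr_K state_mem diff)
qed

end
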